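(* Let $d\ge 2$ and $p\ge 1$ be integers and let $G$ be a $\{K_{1,d},S_p,T_p\}$-free graph. Then $\mathsf{tree}\text{-}\alpha(G)\le 20(d-1)^4(p+1)$.
   Context: Graphs are finite and simple; $G$ is $\mathcal{F}$-free if it has no induced subgraph isomorphic to a member of $\mathcal{F}$. $K_{1,d}$ is the star with $d$ leaves. For $p\ge1$, $S_p$ is the graph obtained from the claw $K_{1,3}$ by subdividing each of its three edges $p-1$ times (a subdivided star with three legs each of length $p$), and $T_p$ is the line graph of $S_p$. A tree decomposition of $G$ is a pair $(T,\beta)$ with $T$ a tree and $\beta:V(T)\to 2^{V(G)}$ such that every vertex lies in some bag, every edge has both endpoints in some bag, and for each vertex the nodes whose bags contain it induce a subtree. Its independence number is $\max_t\alpha(G[\beta(t)])$; $\mathsf{tree}\text{-}\alpha(G)$ is the minimum independence number over all tree decompositions of $G$. *)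

theory Defs
  imports "Graph_Theory.Graph_Theory"
begin

text \<open>
  Simple graphs are the graphs of \<^theory>\<open>Graph_Theory.Pair_Digraph\<close>: a finite vertex set with
  a symmetric irreflexive relation (\<^const>\<open>pair_graph\<close>), an edge being the two arcs (u,v), (v,u).
\<close>

section \<open>Induced subgraphs, stars, subdivided claws, line graphs\<close>

definition contains_induced :: "('a, 'b) pre_digraph \<Rightarrow> ('c, 'd) pre_digraph \<Rightarrow> bool" where
  "contains_induced G H \<longleftrightarrow> (\<exists>K. induced_subgraph K G \<and> digraph_iso K H)"

definition star_graph :: "nat \<Rightarrow> nat pair_pre_digraph" where
  "star_graph d = \<lparr> pverts = {0..d}, parcs = {0} \<times> {1..d} \<union> {1..d} \<times> {0} \<rparr>"

text \<open>
  The claw with each edge subdivided k times. The edges at the centre 0 of the k-th graph lead to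
  3k+1, 3k+2, 3k+3, one on each leg; each step subdivides these three edges once more, with the
  new vertices 3k+4, 3k+5, 3k+6.
\<close>
primrec subdivided_claw :: "nat \<Rightarrow> nat pair_pre_digraph" where
  "subdivided_claw 0 = star_graph 3"
| "subdivided_claw (Suc k) =
     subdivide (subdivide (subdivide (subdivided_claw k)
       (0, 3*k + 1) (3*k + 4)) (0, 3*k + 2) (3*k + 5)) (0, 3*k + 3) (3*k + 6)"

definition S_graph :: "nat \<Rightarrow> nat pair_pre_digraph" where
  "S_graph p = subdivided_claw (p - 1)"

definition edges :: "'a pair_pre_digraph \<Rightarrow> 'a set set" where
  "edges G = {{u, v} |u v. (u, v) \<in> parcs G}"

definition line_graph :: "'a pair_pre_digraph \<Rightarrow> 'a set pair_pre_digraph" where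
  "line_graph G = \<lparr> pverts = edges G,
     parcs = {(e, f). e \<in> edges G \<and> f \<in> edges G \<and> e \<noteq> f \<and> e \<inter> f \<noteq> {}} \<rparr>"

definition T_graph :: "nat \<Rightarrow> nat set pair_pre_digraph" where
  "T_graph p = line_graph (S_graph p)"


section \<open>Tree decompositions and tree-independence number\<close>

definition independent_set :: "('a, 'b) pre_digraph \<Rightarrow> 'a set \<Rightarrow> bool" where
  "independent_set G I \<longleftrightarrow> I \<subseteq> verts G \<and> (\<forall>u\<in>I. \<forall>v\<in>I. \<not> u \<rightarrow>\<^bsub>G\<^esub> v)"

definition independence_number :: "('a, 'b) pre_digraph \<Rightarrow> nat" where
  "independence_number G = Max {card I |I. independent_set G I}"

text \<open>
  The library's \<^const>\<open>tree\<close> does not fit undirected trees: in a symmetric digraph every edge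
  gives a directed cycle of length 2. Cycles of an undirected graph have length at least 3.
  Trees are nonempty, as \<^const>\<open>connected\<close> requires a vertex.
\<close>
definition undirected_tree :: "('a, 'b) pre_digraph \<Rightarrow> bool" where
  "undirected_tree T \<longleftrightarrow> graph T \<and> connected T \<and>
     \<not> (\<exists>p. pre_digraph.cycle T p \<and> 3 \<le> length p)"

definition tree_decomposition ::
    "'a pair_pre_digraph \<Rightarrow> 't pair_pre_digraph \<Rightarrow> ('t \<Rightarrow> 'a set) \<Rightarrow> bool" where
  "tree_decomposition G T \<beta> \<longleftrightarrow>
     undirected_tree (with_proj T) \<and>
     (\<forall>t\<in>pverts T. \<beta> t \<subseteq> pverts G) \<and>
     (\<forall>v\<in>pverts G. \<exists>t\<in>pverts T. v \<in> \<beta> t) \<and>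
     (\<forall>(u, v)\<in>parcs G. \<exists>t\<in>pverts T. u \<in> \<beta> t \<and> v \<in> \<beta> t) \<and>
     (\<forall>v\<in>pverts G. undirected_tree (with_proj T \<restriction> {t \<in> pverts T. v \<in> \<beta> t}))"

definition decomposition_independence_number ::
    "'a pair_pre_digraph \<Rightarrow> 't pair_pre_digraph \<Rightarrow> ('t \<Rightarrow> 'a set) \<Rightarrow> nat" where
  "decomposition_independence_number G T \<beta> =
     Max ((\<lambda>t. independence_number (with_proj G \<restriction> \<beta> t)) ` pverts T)"

text \<open>
  Decomposition trees are finite, so their nodes may be taken to be natural numbers. The minimum
  exists by \<open>tree_alpha_attained\<close> below.
\<close>
definition tree_alpha :: "'a pair_pre_digraph \<Rightarrow> nat" where
  "tree_alpha G = (LEAST k. \<exists>(T :: nat pair_pre_digraph) \<beta>.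
     tree_decomposition G T \<beta> \<and> decomposition_independence_number G T \<beta> = k)"


section \<open>Sanity checks\<close>

lemma star_graph_complete_bipartite: "complete_bipartite_digraph 1 d (with_proj (star_graph d))"
proof -
  have "pair_graph (star_graph d)"
    by unfold_locales (auto simp: star_graph_def symmetric_def sym_def)
  then have "graph (with_proj (star_graph d))"
    by (rule pair_graph.pair_graphD_graph)
  moreover have "pverts (star_graph d) = {0} \<union> {1..d}" "{0} \<inter> {1..d} = {}"
    by (auto simp: star_graph_def)
  moreover have "parcs (star_graph d) = {0} \<times> {1..d} \<union> {1..d} \<times> {0}"
    by (simp add: star_graph_def)
  ultimately show ?thesis
    unfolding complete_bipartite_digraph_def
    by (intro conjI exI[of _ "{0}"] exI[of _ "{1..d}"]) simp_all
qed

lemma subdivided_claw_explicit: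
  "pverts (subdivided_claw k) = {0..3*k + 3}"
  "(x, y) \<in> parcs (subdivided_claw k) \<longleftrightarrow>
     x = 0 \<and> 3*k + 1 \<le> y \<and> y \<le> 3*k + 3 \<or> y = 0 \<and> 3*k + 1 \<le> x \<and> x \<le> 3*k + 3 \<or>
     1 \<le> y \<and> y \<le> 3*k \<and> x = y + 3 \<or> 1 \<le> x \<and> x \<le> 3*k \<and> y = x + 3"
proof (induction k arbitrary: x y)
  case 0
  { case 1 show ?case by (simp add: star_graph_def)
  next
    case 2 show ?case by (auto simp: star_graph_def) }
next
  case (Suc k)
  { case 1 show ?case by (auto simp: subdivide.simps Suc.IH(1))
  next
    case 2 show ?case
      unfolding subdivided_claw.simps subdivide.simps pair_pre_digraph.simps
        Un_iff Diff_iff insert_iff empty_iff Suc.IH(2) prod.inject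
      by presburger }
qed

lemma undirected_tree_singleton:
  "undirected_tree (with_proj \<lparr> pverts = {t}, parcs = {} \<rparr>)" (is "undirected_tree (with_proj ?T)")
proof -
  interpret T: pair_graph ?T
    by unfold_locales (auto simp: symmetric_def sym_def)
  have "connected (with_proj ?T)"
    unfolding connected_def strongly_connected_def
    by (auto simp: mk_symmetric_def reachable_def)
  moreover have "\<not> T.cycle q" for q
    by (cases q) (auto simp: T.cycle_def T.awalk_Cons_iff)
  ultimately show ?thesis
    unfolding undirected_tree_def using T.pair_graphD_graph by blast
qed

lemma tree_alpha_attained:
  assumes "pair_graph G"
  shows "\<exists>(T :: nat pair_pre_digraph) \<beta>.
    tree_decomposition G T \<beta> \<and> decomposition_independence_number G T \<beta> = tree_alpha G"
proof -
  interpret pair_graph G by fact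
  let ?T = "\<lparr> pverts = {0 :: nat}, parcs = {} \<rparr>"
  have restr: "with_proj ?T \<restriction> {0} = with_proj ?T"
    by (simp add: induce_subgraph_def with_proj_def)
  have "tree_decomposition G ?T (\<lambda>_. pverts G)"
    unfolding tree_decomposition_def using undirected_tree_singleton[of "0 :: nat"]
    by (auto simp: restr dest: in_arcsD1 in_arcsD2)
  then have "\<exists>k (T :: nat pair_pre_digraph) \<beta>.
      tree_decomposition G T \<beta> \<and> decomposition_independence_number G T \<beta> = k"
    by blast
  then show ?thesis
    unfolding tree_alpha_def by (rule LeastI_ex)
qed

end

theory Submission
  imports Defs
begin

text \<open>
  Suppose that for some independent set \<open>I\<close> no set \<open>N[Z]\<close> with \<open>|Z| \<le> 3p + 1\<close> is a balanced separator, so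
  that every \<open>G - N[Z]\<close> has a component containing more than half of \<open>I\<close>. Grow an induced path as in
  Gyarfas' argument, always towards the heavy component \<open>C\<close>. A neighbour \<open>x\<close> of \<open>C\<close> with a neighbour on
  the path must have one among the first or last \<open>p\<close> vertices of the path: otherwise a second Gyarfas path, of
  length \<open>p\<close> from \<open>x\<close> into \<open>C\<close>, completes an induced \<open>S_p\<close> or \<open>T_p\<close>. Hence \<open>C\<close> is cut off by the
  neighbourhoods of the two ends alone, and the path can be prolonged forever, which is absurd.

  As \<open>G\<close> is \<open>K_{1,d}\<close>-free, the separators have independence number at most \<open>k = (3p + 1)(d - 1)\<close>. The usual
  recursion turning balanced separators into a tree decomposition, run with independence numbers in place
  of cardinalities, then gives \<open>tree-\<alpha>(G) \<le> 5k\<close>.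
\<close>

section \<open>Tree decompositions from the running intersection property\<close>

lemma pawalk_verts_eq: "pcas u q v \<Longrightarrow> pawalk_verts u q = map fst q @ [v]"
  by (induction q arbitrary: u) auto

lemma pcas_nth_Suc: "pcas u q v \<Longrightarrow> Suc i < length q \<Longrightarrow> snd (q ! i) = fst (q ! Suc i)"
proof (induction q arbitrary: u i)
  case (Cons e q)
  show ?case
  proof (cases i)
    case 0
    with Cons show ?thesis by (cases q) auto
  next
    case (Suc j)
    with Cons show ?thesis by auto
  qed
qed simp

lemma pcas_fst_hd: "pcas u q v \<Longrightarrow> q \<noteq> [] \<Longrightarrow> fst (q ! 0) = u"
  by (cases q) auto

lemma pcas_snd_last: "pcas u q v \<Longrightarrow> q \<noteq> [] \<Longrightarrow> snd (q ! (length q - 1)) = v"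
  by (induction q arbitrary: u) (fastforce simp: nth_Cons split: nat.splits)+

text \<open>The largest node of a cycle would have two distinct smaller neighbours, but its only smaller
  neighbour is its parent.\<close>
lemma undirected_tree_parent:
  fixes \<pi> :: "nat \<Rightarrow> nat"
  assumes X: "finite X" "m \<in> X"
    and less: "\<And>x. x > 0 \<Longrightarrow> \<pi> x < x"
    and par: "\<And>x. x \<in> X \<Longrightarrow> x \<noteq> m \<Longrightarrow> x > 0 \<and> \<pi> x \<in> X"
  shows "undirected_tree (with_proj \<lparr> pverts = X, parcs =
    {(x, y). x \<in> X \<and> y \<in> X \<and> (0 < x \<and> y = \<pi> x \<or> 0 < y \<and> x = \<pi> y)} \<rparr>)"
    (is "undirected_tree (with_proj ?T)")
proof -
  have "parcs ?T \<subseteq> X \<times> X" by auto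
  then have "finite (parcs ?T)" using X(1) finite_subset by blast
  moreover have "\<pi> x \<noteq> x" "x \<noteq> \<pi> x" if "0 < x" for x using less[OF that] by auto
  ultimately interpret T: pair_graph ?T
    using X(1) by unfold_locales (auto simp: symmetric_def sym_def)
  have sym: "symmetric (with_proj ?T)" by (rule T.pair_sym_arcs)
  have reach: "x \<rightarrow>\<^sup>*\<^bsub>with_proj ?T\<^esub> m" if "x \<in> X" for x
    using that
  proof (induction x rule: less_induct)
    case (less x)
    show ?case
    proof (cases "x = m")
      case True
      with X(2) show ?thesis by (auto intro: T.reachable_refl)
    next
      case False
      note xp = par[OF less.prems False]
      then have "(x, \<pi> x) \<in> parcs ?T" using less.prems by auto
      moreover have "\<pi> x \<rightarrow>\<^sup>*\<^bsub>with_proj ?T\<^esub> m"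
        using less.IH[of "\<pi> x"] assms(3) xp by blast
      ultimately show ?thesis
        by (auto intro: T.adj_reachable_trans)
    qed
  qed
  have "connected (with_proj ?T)"
    unfolding connected_def
  proof (rule strongly_connectedI)
    show "verts (with_proj (mk_symmetric (with_proj ?T))) \<noteq> {}" using X(2) by auto
    fix u v assume "u \<in> verts (with_proj (mk_symmetric (with_proj ?T)))"
      "v \<in> verts (with_proj (mk_symmetric (with_proj ?T)))"
    then have "u \<in> X" "v \<in> X" by auto
    then have "u \<rightarrow>\<^sup>*\<^bsub>with_proj ?T\<^esub> v"
      using reach symmetric_reachable[OF sym] T.reachable_trans by blast
    then show "u \<rightarrow>\<^sup>*\<^bsub>with_proj (mk_symmetric (with_proj ?T))\<^esub> v"
      by (rule T.reachable_mk_symmetricI)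
  qed
  moreover have False if cyc: "T.cycle q" and "3 \<le> length q" for q
  proof -
    obtain u where u: "T.awalk u q u" "distinct (tl (pawalk_verts u q))" "q \<noteq> []"
      using cyc unfolding T.cycle_def by blast
    have cas: "pcas u q u" and arcs: "set q \<subseteq> parcs ?T" using u(1) by (auto simp: T.awalk_def)
    let ?n = "length q"
    \<comment> \<open>Indices modulo the length treat all vertices of the cycle alike, the first and
      the last included.\<close>
    define w where "w i = fst (q ! (i mod ?n))" for i
    have n: "?n \<ge> 3" by fact
    have "distinct (map fst q)"
      using u(2,3) pcas_fst_hd[OF cas] unfolding pawalk_verts_eq[OF cas] by (cases q) auto
    then have inj: "i mod ?n = j mod ?n" if "w i = w j" for i j
      using that u(3) nth_eq_iff_index_eq[of "map fst q" "i mod ?n" "j mod ?n"]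
      by (simp add: w_def)
    have next_w: "snd (q ! (i mod ?n)) = w (Suc i)" for i
    proof (cases "Suc (i mod ?n) < ?n")
      case True
      then have "Suc i mod ?n = Suc (i mod ?n)" using mod_Suc by auto
      with True show ?thesis by (simp add: w_def pcas_nth_Suc[OF cas])
    next
      case False
      have "i mod ?n < ?n" using n by (intro mod_less_divisor) auto
      with False have i: "i mod ?n = ?n - 1" "Suc i mod ?n = 0"
        using mod_Suc[of i ?n] by auto
      show ?thesis
        unfolding w_def i using pcas_snd_last[OF cas u(3)] pcas_fst_hd[OF cas u(3)] by simp
    qed
    have arc: "(w i, w (Suc i)) \<in> parcs ?T" for i
    proof -
      have "q ! (i mod ?n) \<in> set q" using n by (intro nth_mem mod_less_divisor) auto
      moreover have "q ! (i mod ?n) = (w i, w (Suc i))"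
        unfolding next_w[symmetric] by (simp add: w_def)
      ultimately show ?thesis using arcs by auto
    qed
    have fin: "finite (range w)"
      by (rule finite_subset[OF _ X(1)]) (use arc in auto)
    obtain i where i: "w i = Max (range w)" using Max_in[OF fin] by fastforce
    have per: "w (i + ?n) = w i" by (simp add: w_def)
    \<comment> \<open>The predecessor of \<open>i\<close> on the cycle; adding \<open>?n\<close>
      first avoids truncated subtraction at \<open>i = 0\<close>.\<close>
    define a where "a = i + ?n - 1"
    have a: "Suc a = i + ?n" using n by (simp add: a_def)
    have "w a \<le> w i" "w (Suc i) \<le> w i" using fin i by auto
    moreover have "(w a, w i) \<in> parcs ?T" using arc[of a] per a by simp
    moreover have "(w i, w (Suc i)) \<in> parcs ?T" by (rule arc)
    ultimately have "w a = \<pi> (w i)" "w (Suc i) = \<pi> (w i)"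
      using less by (auto dest: leD)
    \<comment> \<open>Both cyclic neighbours of the largest vertex are its parent, so their
      positions agree modulo \<open>?n\<close>. They differ by \<open>?n - 2\<close>, which
      \<open>?n\<close> cannot divide as \<open>3 \<le> ?n\<close>.\<close>
    then have "a mod ?n = Suc i mod ?n" using inj by simp
    then have "(i + (?n - 1)) mod ?n = (i + 1) mod ?n" using n by (simp add: a_def)
    then have "?n dvd (i + (?n - 1)) - (i + 1)"
      using n by (intro mod_eq_dvd_iff_nat[THEN iffD1]) auto
    then have "?n \<le> (i + (?n - 1)) - (i + 1)" using n by (intro dvd_imp_le) auto
    then show False using n by simp
  qed
  ultimately show ?thesis
    unfolding undirected_tree_def using T.pair_graphD_graph by blast
qed

text \<open>The running intersection property; \<open>A\<close> serves as the parent of \<open>B\<close> in a decomposition tree.\<close>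
inductive rip :: "'a set list \<Rightarrow> bool" where
  single: "rip [B]"
| snoc: "rip bs \<Longrightarrow> A \<in> set bs \<Longrightarrow> B \<inter> \<Union>(set bs) \<subseteq> A \<Longrightarrow> rip (bs @ [B])"

lemma rip_nonempty: "rip bs \<Longrightarrow> bs \<noteq> []"
  by (induction rule: rip.induct) auto

text \<open>Only the head of \<open>cs\<close> needs a new parent, namely \<open>A\<close>. Any
  later bag keeps its parent: what it shares with \<open>bs\<close> lies in \<open>hd cs\<close>,
  hence already in the union of its predecessors in \<open>cs\<close>.\<close>

lemma rip_append:
  assumes "rip cs" "rip bs" "A \<in> set bs" "\<Union>(set cs) \<inter> \<Union>(set bs) \<subseteq> A \<inter> hd cs"
  shows "rip (bs @ cs)"
  using assms
proof (induction cs rule: rip.induct)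
  case (single B)
  then show ?case by (auto intro: rip.snoc)
next
  case (snoc cs C B)
  from snoc.prems(3) have "\<Union>(set cs) \<inter> \<Union>(set bs) \<subseteq> A \<inter> hd cs"
    using rip_nonempty[OF snoc.hyps(1)] by auto
  then have "rip (bs @ cs)" using snoc by blast
  moreover have "B \<inter> \<Union>(set (bs @ cs)) \<subseteq> C"
  proof
    fix x assume x: "x \<in> B \<inter> \<Union>(set (bs @ cs))"
    have "x \<in> \<Union>(set cs)"
    proof (cases "x \<in> \<Union>(set bs)")
      case True
      then have "x \<in> hd cs"
        using x snoc.prems(3) rip_nonempty[OF snoc.hyps(1)] by auto
      then show ?thesis using rip_nonempty[OF snoc.hyps(1)] by (meson UnionI hd_in_set)
    qed (use x in auto)
    then show "x \<in> C" using x snoc.hyps(3) by auto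
  qed
  ultimately have "rip ((bs @ cs) @ [B])"
    using snoc.hyps(2) by (intro rip.snoc[where A = C]) auto
  then show ?case by simp
qed

text \<open>Turns the parent bag into an earlier index, the form of parent that
  \<open>undirected_tree_parent\<close> accepts.\<close>

lemma rip_parent:
  assumes "rip bs" "0 < i" "i < length bs"
  shows "\<exists>j<i. bs ! i \<inter> \<Union>(set (take i bs)) \<subseteq> bs ! j"
  using assms
proof (induction rule: rip.induct)
  case (snoc bs A B)
  show ?case
  proof (cases "i < length bs")
    case True
    with snoc show ?thesis by (auto simp: nth_append)
  next
    case False
    with snoc.prems have i: "i = length bs" by simp
    obtain j where "j < length bs" "bs ! j = A" using snoc.hyps(2) by (metis in_set_conv_nth)
    then show ?thesis using snoc.hyps(3) i by (auto simp: nth_append intro!: exI[of _ j])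
  qed
qed simp

text \<open>Each node is joined to its parent. The nodes whose bags contain \<open>v\<close> form a
  subtree rooted at the least of them: for any other such node \<open>v\<close> also occurs in an
  earlier bag, hence in the parent's bag.\<close>

lemma tree_decomposition_rip:
  fixes G :: "'a pair_pre_digraph"
  assumes rip: "rip bs" and un: "\<Union>(set bs) = pverts G"
    and edge: "\<And>u v. (u, v) \<in> parcs G \<Longrightarrow> \<exists>B\<in>set bs. u \<in> B \<and> v \<in> B"
  obtains T :: "nat pair_pre_digraph"
  where "pverts T = {..<length bs}" "tree_decomposition G T (\<lambda>i. bs ! i)"
proof -
  \<comment> \<open>Beyond the list the parent defaults to 0, so that parents are smaller at every
    positive index.\<close>
  have "\<forall>i. \<exists>j. 0 < i \<longrightarrow> j < i \<and> (i < length bs \<longrightarrow> bs ! i \<inter> \<Union>(set (take i bs)) \<subseteq> bs ! j)"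
  proof
    fix i
    show "\<exists>j. 0 < i \<longrightarrow> j < i \<and> (i < length bs \<longrightarrow> bs ! i \<inter> \<Union>(set (take i bs)) \<subseteq> bs ! j)"
    proof (cases "i < length bs")
      case True
      then show ?thesis using rip_parent[OF rip] by blast
    qed (auto intro: exI[of _ 0])
  qed
  then obtain \<pi> where par: "\<And>i. 0 < i \<Longrightarrow> \<pi> i < i"
    "\<And>i. 0 < i \<Longrightarrow> i < length bs \<Longrightarrow> bs ! i \<inter> \<Union>(set (take i bs)) \<subseteq> bs ! \<pi> i"
    by metis
  \<comment> \<open>Relative to a node set \<open>X\<close>, so that one lemma serves the whole tree
    and the subtree of each vertex.\<close>
  define A where "A X = {(x, y). x \<in> X \<and> y \<in> X \<and> (0 < x \<and> y = \<pi> x \<or> 0 < y \<and> x = \<pi> y)}" for X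
  define T where "T = \<lparr> pverts = {..<length bs}, parcs = A {..<length bs} \<rparr>"
  have ne: "bs \<noteq> []" using rip by (rule rip_nonempty)
  have verts: "pverts T = {..<length bs}" by (simp add: T_def)
  have tree: "undirected_tree (with_proj T)"
    unfolding T_def A_def
    by (rule undirected_tree_parent[where m = 0]) (use ne par(1) less_trans in auto)
  have subtree: "undirected_tree (with_proj T \<restriction> {t \<in> pverts T. v \<in> bs ! t})"
    if v: "v \<in> pverts G" for v
  proof -
    let ?X = "{t \<in> pverts T. v \<in> bs ! t}"
    have eq: "with_proj T \<restriction> ?X = with_proj \<lparr> pverts = ?X, parcs = A ?X \<rparr>"
      unfolding with_proj_def induce_subgraph_def by (auto simp: T_def A_def)
    have fin: "finite ?X" by (simp add: verts)
    obtain B where "B \<in> set bs" "v \<in> B" using v un by auto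
    then have X: "?X \<noteq> {}" by (auto simp: verts in_set_conv_nth)
    show ?thesis
      unfolding eq A_def
    proof (rule undirected_tree_parent[where m = "Min ?X"])
      fix x assume x: "x \<in> ?X" "x \<noteq> Min ?X"
      let ?m = "Min ?X"
      have m: "?m \<in> ?X" using fin X by (rule Min_in)
      have "?m < x" using x fin by (metis Min_le le_neq_implies_less)
      moreover from this have "bs ! ?m \<in> set (take x bs)"
        using x(1) by (auto simp: in_set_conv_nth verts intro!: exI[of _ ?m])
      moreover have "v \<in> bs ! ?m" using m by blast
      ultimately have "v \<in> bs ! \<pi> x" using par(2)[of x] x(1) by (auto simp: verts)
      moreover have "x > 0" using \<open>?m < x\<close> by simp
      ultimately show "x > 0 \<and> \<pi> x \<in> ?X"
        using par(1)[of x] x(1) by (auto simp: verts)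
    qed (use fin X par(1) Min_in in auto)
  qed
  have "tree_decomposition G T (\<lambda>i. bs ! i)"
    unfolding tree_decomposition_def
  proof (intro conjI ballI)
    show "bs ! t \<subseteq> pverts G" if "t \<in> pverts T" for t
      using that unfolding un[symmetric] verts by (auto intro: nth_mem)
    show "\<exists>t\<in>pverts T. v \<in> bs ! t" if "v \<in> pverts G" for v
      using that unfolding un[symmetric] verts by (auto simp: in_set_conv_nth)
    show "case e of (u, v) \<Rightarrow> \<exists>t\<in>pverts T. u \<in> bs ! t \<and> v \<in> bs ! t" if "e \<in> parcs G" for e
      using edge[of "fst e" "snd e"] that unfolding verts by (auto simp: in_set_conv_nth)
  qed (use tree subtree in blast)+
  with verts that show ?thesis by blast
qed

lemma arcs_ends_induce_with_proj: "arcs_ends (with_proj G \<restriction> B) = parcs G \<inter> B \<times> B"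
  unfolding arcs_ends_conv by (auto simp: image_iff)

lemma tree_alpha_le_rip:
  assumes G: "pair_graph G" and rip: "rip bs" and un: "\<Union>(set bs) = pverts G"
    and edge: "\<And>u v. (u, v) \<in> parcs G \<Longrightarrow> \<exists>B\<in>set bs. u \<in> B \<and> v \<in> B"
    and alpha: "\<And>B I. B \<in> set bs \<Longrightarrow> I \<subseteq> B \<Longrightarrow> independent_set (with_proj G) I \<Longrightarrow> card I \<le> k"
  shows "tree_alpha G \<le> k"
proof -
  interpret pair_graph G by fact
  obtain T :: "nat pair_pre_digraph" where T: "pverts T = {..<length bs}"
    and td: "tree_decomposition G T (\<lambda>i. bs ! i)"
    using tree_decomposition_rip[OF rip un edge] by metis
  have "independence_number (with_proj G \<restriction> B) \<le> k" if B: "B \<in> set bs" for B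
  proof -
    have BV: "B \<subseteq> pverts G" using un B by auto
    let ?S = "{card I |I. independent_set (with_proj G \<restriction> B) I}"
    have "?S \<subseteq> card ` Pow B" by (auto simp: independent_set_def)
    moreover have "finite B" using BV pair_finite_verts finite_subset by blast
    ultimately have "finite ?S" using finite_subset by blast
    moreover have "0 \<in> ?S"
      by (auto simp: independent_set_def intro!: exI[of _ "{}"])
    moreover have "card I \<le> k" if I: "independent_set (with_proj G \<restriction> B) I" for I
    proof (rule alpha[OF B])
      show "I \<subseteq> B" using I unfolding independent_set_def by simp
      then show "independent_set (with_proj G) I"
        using I BV unfolding independent_set_def arcs_ends_induce_with_proj by auto
    qed
    ultimately show ?thesis unfolding independence_number_def by (subst Max_le_iff) auto
  qed
  then have "decomposition_independence_number G T (\<lambda>i. bs ! i) \<le> k"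
    unfolding decomposition_independence_number_def T
    using rip_nonempty[OF rip] by (subst Max_le_iff) (auto simp: lessThan_empty_iff)
  moreover have "tree_alpha G \<le> decomposition_independence_number G T (\<lambda>i. bs ! i)"
    unfolding tree_alpha_def using td by (intro Least_le) auto
  ultimately show ?thesis by linarith
qed

section \<open>Balanced separators\<close>

text \<open>Connectedness of the subgraph induced by \<open>D\<close>, expressed by cuts because
  every later use asks for an arc leaving a given set.\<close>

definition linked :: "'a pair_pre_digraph \<Rightarrow> 'a set \<Rightarrow> bool" where
  "linked G D \<longleftrightarrow> (\<forall>Z. Z \<inter> D \<noteq> {} \<longrightarrow> D - Z \<noteq> {} \<longrightarrow> (\<exists>a\<in>D \<inter> Z. \<exists>b\<in>D - Z. (a, b) \<in> parcs G))"

text \<open>The connected components of the subgraph induced by \<open>X\<close>; closure under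
  neighbours in \<open>X\<close> takes the place of maximality.\<close>

definition component :: "'a pair_pre_digraph \<Rightarrow> 'a set \<Rightarrow> 'a set \<Rightarrow> bool" where
  "component G X D \<longleftrightarrow> D \<subseteq> X \<and> D \<noteq> {} \<and> linked G D \<and>
     (\<forall>a\<in>D. \<forall>b\<in>X. (a, b) \<in> parcs G \<longrightarrow> b \<in> D)"

text \<open>The bound \<alpha>(G[W]) \<le> k, without a maximum whose existence would have to be
  shown each time.\<close>

definition alpha_le :: "'a pair_pre_digraph \<Rightarrow> 'a set \<Rightarrow> nat \<Rightarrow> bool" where
  "alpha_le G W k \<longleftrightarrow> (\<forall>I. I \<subseteq> W \<longrightarrow> independent_set (with_proj G) I \<longrightarrow> card I \<le> k)"

lemma independent_set_iff:
  "independent_set (with_proj G) I \<longleftrightarrow> I \<subseteq> pverts G \<and> (\<forall>u\<in>I. \<forall>v\<in>I. (u, v) \<notin> parcs G)"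
  by (simp add: independent_set_def)

lemma independent_set_subset:
  "independent_set (with_proj G) I \<Longrightarrow> J \<subseteq> I \<Longrightarrow> independent_set (with_proj G) J"
  unfolding independent_set_iff by blast

text \<open>Otherwise the cut of \<open>D\<close> along \<open>D'\<close> is crossed by an arc that
  leaves the component \<open>D'\<close> within \<open>X\<close>.\<close>

lemma linked_subset_component:
  assumes "linked G D" "D \<subseteq> X" "component G X D'" "D \<inter> D' \<noteq> {}"
  shows "D \<subseteq> D'"
proof (rule ccontr)
  assume "\<not> D \<subseteq> D'"
  with assms(1,4) obtain a b where "a \<in> D \<inter> D'" "b \<in> D - D'" "(a, b) \<in> parcs G"
    unfolding linked_def by blast
  with assms(2,3) show False unfolding component_def by blast
qed

section \<open>Components and independence numbers\<close>

context pair_graph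
begin

lemma arc_sym: "(u, v) \<in> parcs G \<Longrightarrow> (v, u) \<in> parcs G"
  using pair_sym_arcs by (auto simp: symmetric_def sym_def)

lemma arc_irrefl: "(u, u) \<notin> parcs G"
  using pair_no_loops by fastforce

lemma ex_component:
  assumes "u \<in> X"
  obtains D where "component G X D" "u \<in> D"
proof -
  define R where "R = parcs G \<inter> X \<times> X"
  define D where "D = {v. (u, v) \<in> R\<^sup>*}"
  have DX: "D \<subseteq> X"
  proof
    fix v assume "v \<in> D"
    then have "(u, v) \<in> R\<^sup>*" by (simp add: D_def)
    then show "v \<in> X" by (cases rule: rtranclE) (use assms in \<open>auto simp: R_def\<close>)
  qed
  have sym: "(y, x) \<in> R\<^sup>*" if "(x, y) \<in> R\<^sup>*" for x y
  proof -
    have "sym R" using arc_sym by (auto simp: R_def sym_def)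
    then show ?thesis using that by (meson sym_rtrancl symE)
  qed
  have "linked G D"
    unfolding linked_def
  proof (intro allI impI)
    fix Z assume "Z \<inter> D \<noteq> {}" "D - Z \<noteq> {}"
    then obtain x y where xy: "x \<in> Z" "x \<in> D" "y \<in> D" "y \<notin> Z" by blast
    then have "(x, y) \<in> R\<^sup>*" using sym[of u x] by (auto simp: D_def)
    \<comment> \<open>Somewhere a walk from \<open>x\<close> in \<open>Z\<close> to \<open>y\<close>
      outside \<open>Z\<close> steps out of \<open>Z\<close>; the induction follows the walk to its
      first such step.\<close>
    then have "y \<notin> Z \<longrightarrow> (\<exists>a\<in>D \<inter> Z. \<exists>b\<in>D - Z. (a, b) \<in> parcs G)"
    proof (induction rule: rtrancl_induct)
      case base
      with xy show ?case by blast
    next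
      case (step y z)
      have "(u, y) \<in> R\<^sup>*" using step.hyps(1) xy(2) by (simp add: D_def)
      then have "y \<in> D" "z \<in> D" using step.hyps(2) by (auto simp: D_def)
      with step show ?case by (auto simp: R_def)
    qed
    with xy show "\<exists>a\<in>D \<inter> Z. \<exists>b\<in>D - Z. (a, b) \<in> parcs G" by blast
  qed
  moreover have "b \<in> D" if "a \<in> D" "b \<in> X" "(a, b) \<in> parcs G" for a b
  proof -
    have "(a, b) \<in> R" using that DX by (auto simp: R_def)
    with that(1) show ?thesis by (auto simp: D_def)
  qed
  moreover have "u \<in> D" by (simp add: D_def)
  ultimately have "component G X D" using DX unfolding component_def by blast
  with that \<open>u \<in> D\<close> show ?thesis by blast
qed

text \<open>Carries the balance of a separator of the whole graph over to the vertex subsets met in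
  the recursion.\<close>

lemma component_in_component:
  assumes "component G X D" "X \<subseteq> Y"
  obtains D' where "component G Y D'" "D \<subseteq> D'"
proof -
  obtain u where "u \<in> D" using assms(1) unfolding component_def by blast
  moreover obtain D' where D': "component G Y D'" "u \<in> D'"
    using ex_component[of u Y] assms calculation unfolding component_def by blast
  ultimately have "D \<subseteq> D'"
    using linked_subset_component[of G D Y D'] assms unfolding component_def by blast
  with D' that show ?thesis by blast
qed

lemma alpha_le_Un:
  assumes "alpha_le G A a" "alpha_le G B b"
  shows "alpha_le G (A \<union> B) (a + b)"
  unfolding alpha_le_def
proof (intro allI impI)
  fix I assume I: "I \<subseteq> A \<union> B" "independent_set (with_proj G) I"
  then have "finite I" using pair_finite_verts finite_subset unfolding independent_set_iff by blast
  have "card I = card ((I \<inter> A) \<union> (I - A))" by (simp add: Int_Diff_Un)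
  also have "\<dots> \<le> card (I \<inter> A) + card (I - A)" by (rule card_Un_le)
  also have "card (I \<inter> A) \<le> a"
    using assms(1) independent_set_subset[OF I(2), of "I \<inter> A"] unfolding alpha_le_def by blast
  also have "card (I - A) \<le> b"
  proof -
    have "I - A \<subseteq> B" using I(1) by blast
    then show ?thesis
      using assms(2) independent_set_subset[OF I(2), of "I - A"] unfolding alpha_le_def by blast
  qed
  finally show "card I \<le> a + b" by simp
qed

lemma alpha_le_subset: "alpha_le G A a \<Longrightarrow> B \<subseteq> A \<Longrightarrow> alpha_le G B a"
  unfolding alpha_le_def by blast

lemma alpha_le_mono: "alpha_le G A a \<Longrightarrow> a \<le> b \<Longrightarrow> alpha_le G A b"
  unfolding alpha_le_def using le_trans by blast

text \<open>An independent subset of \<open>W \<inter> D\<close> may replace the part of a maximum independent set \<open>I\<close> of \<open>W\<close>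
  lying in \<open>D \<union> S\<close>.\<close>
lemma alpha_le_component:
  assumes W: "W \<subseteq> U" "alpha_le G W (4 * k)"
    and I: "I \<subseteq> W" "independent_set (with_proj G) I" "card I = 4 * k"
    and D: "component G (U - S) D"
    and S: "alpha_le G S k" and half: "2 * card (I \<inter> D) \<le> card I"
  shows "alpha_le G (W \<inter> D) (3 * k)"
  unfolding alpha_le_def
proof (intro allI impI)
  fix J assume J: "J \<subseteq> W \<inter> D" "independent_set (with_proj G) J"
  have fin: "finite I" "finite J"
    using I(2) J(2) pair_finite_verts finite_subset unfolding independent_set_iff by blast+
  let ?K = "(I - S - D) \<union> J"
  have no: "(a, b) \<notin> parcs G" if "a \<in> J" "b \<in> I - S - D" for a b
    using that J(1) I(1) W(1) D unfolding component_def by blast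
  then have no': "(b, a) \<notin> parcs G" if "a \<in> J" "b \<in> I - S - D" for a b
    using that arc_sym by blast
  have "independent_set (with_proj G) ?K"
    unfolding independent_set_iff
  proof (intro conjI ballI)
    fix u v assume "u \<in> ?K" "v \<in> ?K"
    then show "(u, v) \<notin> parcs G"
      using I(2) J(2) no no' unfolding independent_set_iff by blast
  qed (use I(2) J(2) in \<open>auto simp: independent_set_iff\<close>)
  moreover have "?K \<subseteq> W" using I(1) J(1) by blast
  ultimately have "card ?K \<le> 4 * k" using W(2) unfolding alpha_le_def by blast
  moreover have "card ?K = card (I - S - D) + card J"
    using fin J(1) by (intro card_Un_disjoint) auto
  moreover have "card I \<le> card (I - S - D) + card (I \<inter> S) + card (I \<inter> D)"
  proof -
    have "card I \<le> card ((I - S - D) \<union> (I \<inter> S) \<union> (I \<inter> D))"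
      using fin by (intro card_mono) auto
    then show ?thesis
      using card_Un_le[of "(I - S - D) \<union> (I \<inter> S)" "I \<inter> D"]
        card_Un_le[of "I - S - D" "I \<inter> S"] by linarith
  qed
  moreover have "card (I \<inter> S) \<le> k"
    using S independent_set_subset[OF I(2), of "I \<inter> S"] unfolding alpha_le_def by blast
  \<comment> \<open>Of the \<open>4 * k\<close> elements of \<open>I\<close> at most
    \<open>k\<close> lie in \<open>S\<close> and at most \<open>2 * k\<close> in \<open>D\<close>,
    so \<open>J\<close> shares the bound \<open>4 * k\<close> on \<open>?K\<close> with at least
    \<open>k\<close> others.\<close>
  ultimately show "card J \<le> 3 * k" using I(3) half by linarith
qed

text \<open>For \<open>\<alpha>(W) = 4k\<close>, a separator \<open>S\<close> balanced for a maximum independent set of \<open>W\<close> gives the bag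
  \<open>W \<union> S\<close>, and each component \<open>D\<close> is decomposed with \<open>W \<inter> D \<union> S\<close>, of independence number at most
  \<open>3k + k\<close>, in its head bag.\<close>
lemma rip_of_balanced_separators:
  assumes k: "k > 0"
    and sep: "\<And>I. independent_set (with_proj G) I \<Longrightarrow>
      \<exists>S. alpha_le G S k \<and> (\<forall>D. component G (pverts G - S) D \<longrightarrow> 2 * card (I \<inter> D) \<le> card I)"
    and "W \<subseteq> U" "U \<subseteq> pverts G" "alpha_le G W (4 * k)"
  shows "\<exists>bs. rip bs \<and> \<Union>(set bs) = U \<and> W \<subseteq> hd bs \<and> (\<forall>B\<in>set bs. alpha_le G B (5 * k)) \<and>
    (\<forall>u\<in>U. \<forall>v\<in>U. (u, v) \<in> parcs G \<longrightarrow> (\<exists>B\<in>set bs. u \<in> B \<and> v \<in> B))"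
  using assms(3-)
\<comment> \<open>Enlarging \<open>W\<close> lowers the second summand; passing to a component
  lowers the first and does not raise the second.\<close>
proof (induction "card U + card (U - W)" arbitrary: U W rule: less_induct)
  case less
  note WU = less.prems(1) and UV = less.prems(2) and W = less.prems(3)
  let ?goal = "\<lambda>U W bs. rip bs \<and> \<Union>(set bs) = U \<and> W \<subseteq> hd bs \<and> (\<forall>B\<in>set bs. alpha_le G B (5 * k)) \<and>
    (\<forall>u\<in>U. \<forall>v\<in>U. (u, v) \<in> parcs G \<longrightarrow> (\<exists>B\<in>set bs. u \<in> B \<and> v \<in> B))"
  have fU: "finite U" using UV pair_finite_verts finite_subset by blast
  show ?case
  proof (cases "alpha_le G U (5 * k)")
    case True
    then show ?thesis using WU by (intro exI[of _ "[U]"]) (auto intro: rip.single)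
  next
    case big: False
    show ?thesis
    \<comment> \<open>\<open>W\<close> grows as long as its independence number stays at most
      \<open>4 * k\<close>. Once it is stuck, any further vertex completes an independent set
      \<open>J\<close> of more than \<open>4 * k\<close> vertices.\<close>
    proof (cases "\<exists>v\<in>U - W. alpha_le G (insert v W) (4 * k)")
      case True
      then obtain v where v: "v \<in> U - W" "alpha_le G (insert v W) (4 * k)" by blast
      have "U - insert v W \<subset> U - W" using v(1) by blast
      then have "card (U - insert v W) < card (U - W)"
        using fU by (intro psubset_card_mono) auto
      then have "\<exists>bs. ?goal U (insert v W) bs" using v WU UV by (intro less.hyps) auto
      then show ?thesis by blast
    next
      case False
      have "W \<noteq> U"
      proof
        assume "W = U"
        then have "alpha_le G U (5 * k)"
          using alpha_le_mono[OF W, of "5 * k"] by simp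
        with big show False ..
      qed
      then obtain v where v: "v \<in> U - W" using WU by blast
      then obtain J where J: "J \<subseteq> insert v W" "independent_set (with_proj G) J" "4 * k < card J"
        using False unfolding alpha_le_def by (meson not_le)
      \<comment> \<open>Without \<open>v\<close> the set lies in \<open>W\<close>, which caps it at
        \<open>4 * k\<close>, so exactly \<open>4 * k\<close> vertices remain.\<close>
      define I where "I = J - {v}"
      have "I \<subseteq> J" by (auto simp: I_def)
      moreover have "I \<subseteq> W" using J(1) by (auto simp: I_def)
      ultimately have I: "I \<subseteq> W" "independent_set (with_proj G) I"
        using independent_set_subset[OF J(2)] by simp_all
      have fI: "finite I" by (rule finite_subset[OF subset_trans[OF I(1) WU] fU])
      have "card I \<le> 4 * k" using W I unfolding alpha_le_def by simp
      moreover have "card J - card {v} \<le> card I"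
        unfolding I_def by (rule diff_card_le_card_Diff) simp
      ultimately have cI: "card I = 4 * k" using J(3) by simp
      obtain S0 where S0: "alpha_le G S0 k"
        "\<And>D. component G (pverts G - S0) D \<Longrightarrow> 2 * card (I \<inter> D) \<le> card I"
        using sep[OF I(2)] by blast
      \<comment> \<open>Bags must stay inside \<open>U\<close>. Balance survives, since every
        component of \<open>U - S\<close> lies in one of \<open>pverts G - S0\<close>.\<close>
      define S where "S = S0 \<inter> U"
      have S: "S \<subseteq> U" "alpha_le G S k" using S0(1) alpha_le_subset by (auto simp: S_def)
      have half: "2 * card (I \<inter> D) \<le> card I" if D: "component G (U - S) D" for D
      proof -
        have "U - S \<subseteq> pverts G - S0" using UV by (auto simp: S_def)
        then obtain D' where D': "component G (pverts G - S0) D'" "D \<subseteq> D'"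
          using component_in_component[OF D] by metis
        then have "card (I \<inter> D) \<le> card (I \<inter> D')" using fI by (intro card_mono) auto
        with S0(2)[OF D'(1)] show ?thesis by linarith
      qed
      have bag: "alpha_le G (W \<union> S) (5 * k)" using alpha_le_Un[OF W S(2)] by simp
      have "\<exists>bs. ?goal (D \<union> S) (W \<inter> D \<union> S) bs" if D: "component G (U - S) D" for D
      proof (rule less.hyps)
        have DU: "D \<subseteq> U - S" using D by (simp add: component_def)
        show "W \<inter> D \<union> S \<subseteq> D \<union> S" "D \<union> S \<subseteq> pverts G" using DU S(1) UV by auto
        show "alpha_le G (W \<inter> D \<union> S) (4 * k)"
          using alpha_le_Un[OF alpha_le_component[OF WU W I cI D S(2) half[OF D]] S(2)] by simp
        have "card (D \<union> S) < card U"
        proof (rule psubset_card_mono[OF fU], rule psubsetI)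
          show "D \<union> S \<subseteq> U" using DU S(1) by blast
          \<comment> \<open>Otherwise \<open>I\<close> would be covered by \<open>D\<close> and
            \<open>S\<close>, which contain at most \<open>2 * k\<close> and \<open>k\<close> of its
            \<open>4 * k\<close> elements.\<close>
          show "D \<union> S \<noteq> U"
          proof
            assume "D \<union> S = U"
            then have "card I \<le> card ((I \<inter> D) \<union> (I \<inter> S))"
              using fI I(1) WU by (intro card_mono) auto
            also have "\<dots> \<le> card (I \<inter> D) + card (I \<inter> S)" by (rule card_Un_le)
            also have "card (I \<inter> S) \<le> k"
              using S(2) independent_set_subset[OF I(2), of "I \<inter> S"] unfolding alpha_le_def by blast
            finally show False using half[OF D] cI k by linarith
          qed
        qed
        moreover have "card (D \<union> S - (W \<inter> D \<union> S)) \<le> card (U - W)"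
          using fU DU by (intro card_mono) auto
        ultimately show "card (D \<union> S) + card (D \<union> S - (W \<inter> D \<union> S)) < card U + card (U - W)"
          by linarith
      qed
      then obtain f where f: "\<And>D. component G (U - S) D \<Longrightarrow> ?goal (D \<union> S) (W \<inter> D \<union> S) (f D)"
        by metis
      let ?C = "{D. component G (U - S) D}"
      have "?C \<subseteq> Pow U" by (auto simp: component_def)
      then have fC: "finite ?C" using fU by (meson finite_Pow_iff finite_subset)
      \<comment> \<open>The decompositions of the components are hung one by one below the root bag
        \<open>W \<union> S\<close>. Components being disjoint, a new one meets the earlier bags
        only in \<open>W \<inter> D \<union> S\<close>, which its head bag contains.\<close>
      have glue: "\<exists>bs. rip bs \<and> \<Union>(set bs) = W \<union> S \<union> \<Union>F \<and> hd bs = W \<union> S \<and>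
          (\<forall>B\<in>set bs. alpha_le G B (5 * k)) \<and> (\<forall>D\<in>F. set (f D) \<subseteq> set bs)"
        if "finite F" "F \<subseteq> ?C" for F
        using that
      proof (induction F rule: finite_induct)
        case empty
        show ?case using bag by (intro exI[of _ "[W \<union> S]"]) (auto intro: rip.single)
      next
        case (insert D F)
        then obtain bs where bs: "rip bs" "\<Union>(set bs) = W \<union> S \<union> \<Union>F" "hd bs = W \<union> S"
          "\<forall>B\<in>set bs. alpha_le G B (5 * k)" "\<forall>D\<in>F. set (f D) \<subseteq> set bs" by auto
        have D: "component G (U - S) D" using insert.prems by blast
        note fD = f[OF D]
        have disj: "D \<inter> D' = {}" if "D' \<in> F" for D'
        proof (rule ccontr)
          assume ne: "D \<inter> D' \<noteq> {}"
          have D': "component G (U - S) D'" using insert.prems that by blast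
          have "D \<subseteq> D'" using linked_subset_component[OF _ _ D' ne] D
            by (simp add: component_def)
          moreover have "D' \<subseteq> D" using linked_subset_component[OF _ _ D, of D'] D' ne
            by (simp add: component_def Int_commute)
          ultimately show False using that insert.hyps(2) by auto
        qed
        have int: "\<Union>(set (f D)) \<inter> \<Union>(set bs) \<subseteq> W \<inter> D \<union> S"
          using fD bs(2) disj by blast
        have ne: "bs \<noteq> []" using bs(1) by (rule rip_nonempty)
        have "rip (bs @ f D)"
        proof (rule rip_append[where A = "W \<union> S"])
          show "W \<union> S \<in> set bs" using bs(3) ne hd_in_set by metis
        qed (use fD bs int in blast)+
        moreover have "\<Union>(set (bs @ f D)) = W \<union> S \<union> \<Union>(insert D F)"
          using bs(2) fD by auto
        moreover have "hd (bs @ f D) = W \<union> S" using ne bs(3) by simp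
        ultimately show ?case using bs(4,5) fD by (intro exI[of _ "bs @ f D"]) auto
      qed
      obtain bs where bs: "rip bs" "\<Union>(set bs) = W \<union> S \<union> \<Union>?C" "hd bs = W \<union> S"
          "\<forall>B\<in>set bs. alpha_le G B (5 * k)" "\<forall>D\<in>?C. set (f D) \<subseteq> set bs"
        using glue[OF fC order_refl] by blast
      have root: "W \<union> S \<in> set bs" using hd_in_set[OF rip_nonempty[OF bs(1)]] bs(3) by simp
      have cover: "\<exists>D. component G (U - S) D \<and> u \<in> D" if "u \<in> U - S" for u
        using ex_component[OF that] by blast
      have un: "\<Union>(set bs) = U"
        unfolding bs(2)
      proof
        have "\<Union>?C \<subseteq> U" using \<open>?C \<subseteq> Pow U\<close> by blast
        then show "W \<union> S \<union> \<Union>?C \<subseteq> U" using WU S(1) by blast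
        show "U \<subseteq> W \<union> S \<union> \<Union>?C" using cover by blast
      qed
      have edge: "\<exists>B\<in>set bs. u \<in> B \<and> v \<in> B"
        if uv: "u \<in> U" "v \<in> U" "(u, v) \<in> parcs G" for u v
      proof (cases "u \<in> S \<and> v \<in> S")
        case True
        then show ?thesis by (intro bexI[OF _ root]) simp
      next
        case False
        \<comment> \<open>An end of the arc outside \<open>S\<close> picks the component; the other
          end lies in it too or in \<open>S\<close>.\<close>
        obtain D where D: "component G (U - S) D" "u \<in> D \<union> S" "v \<in> D \<union> S"
        proof (cases "u \<in> S")
          case True
          then have "v \<in> U - S" using False uv by blast
          then show ?thesis using cover[of v] True that by blast
        next
          case u: False
          then obtain D where D: "component G (U - S) D" "u \<in> D" using cover[of u] uv by blast
          then have "v \<in> D \<union> S" using uv unfolding component_def by blast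
          then show ?thesis using D that by blast
        qed
        then obtain B where "B \<in> set (f D)" "u \<in> B" "v \<in> B" using f[OF D(1)] uv(3) by blast
        then show ?thesis using bs(5) D(1) by blast
      qed
      have "W \<subseteq> hd bs" unfolding bs(3) by blast
      with bs(1,4) un edge have "?goal U W bs" by simp
      then show ?thesis by (rule exI)
    qed
  qed
qed

lemma tree_alpha_le_balanced_separators:
  assumes "k > 0"
    and "\<And>I. independent_set (with_proj G) I \<Longrightarrow>
      \<exists>S. alpha_le G S k \<and> (\<forall>D. component G (pverts G - S) D \<longrightarrow> 2 * card (I \<inter> D) \<le> card I)"
  shows "tree_alpha G \<le> 5 * k"
proof -
  have "alpha_le G {} (4 * k)" by (simp add: alpha_le_def)
  then obtain bs where bs: "rip bs" "\<Union>(set bs) = pverts G" "\<forall>B\<in>set bs. alpha_le G B (5 * k)"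
    "\<forall>u\<in>pverts G. \<forall>v\<in>pverts G. (u, v) \<in> parcs G \<longrightarrow> (\<exists>B\<in>set bs. u \<in> B \<and> v \<in> B)"
    using rip_of_balanced_separators[OF assms empty_subsetI order_refl] by blast
  show ?thesis
  proof (rule tree_alpha_le_rip[OF _ bs(1,2)])
    show "pair_graph G" by unfold_locales
    show "\<exists>B\<in>set bs. u \<in> B \<and> v \<in> B" if "(u, v) \<in> parcs G" for u v
      using bs(4) that in_arcsD1[OF that] in_arcsD2[OF that] by simp
    show "card I \<le> 5 * k" if "B \<in> set bs" "I \<subseteq> B" "independent_set (with_proj G) I" for B I
      using bs(3) that unfolding alpha_le_def by simp
  qed
qed

end

section \<open>Finding long claws and their line graphs\<close>

text \<open>Vertices of \<open>G\<close> and of \<open>H\<close> are both named by an index set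
  \<open>J\<close>, so that pairs (leg, distance) can serve as coordinates; the isomorphism is
  \<open>\<kappa>\<close> after the inverse of \<open>\<phi>\<close>.\<close>

lemma (in pair_graph) contains_inducedI:
  assumes \<phi>: "inj_on \<phi> J" "\<phi> ` J \<subseteq> pverts G"
    and \<kappa>: "bij_betw \<kappa> J (pverts H)" and H: "parcs H \<subseteq> pverts H \<times> pverts H"
    and arcs: "\<And>i j. i \<in> J \<Longrightarrow> j \<in> J \<Longrightarrow> (\<phi> i, \<phi> j) \<in> parcs G \<longleftrightarrow> (\<kappa> i, \<kappa> j) \<in> parcs H"
  shows "contains_induced (with_proj G) (with_proj H)"
proof -
  let ?K = "with_proj G \<restriction> \<phi> ` J"
  have ind: "induced_subgraph ?K (with_proj G)"
    using \<phi>(2) by (intro induced_induce) auto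
  define h where "h = \<kappa> \<circ> the_inv_into J \<phi>"
  have h: "h (\<phi> i) = \<kappa> i" if "i \<in> J" for i
    using that \<phi>(1) by (simp add: h_def the_inv_into_f_f)
  have inj\<kappa>: "inj_on \<kappa> J" and im\<kappa>: "\<kappa> ` J = pverts H"
    using \<kappa> by (auto simp: bij_betw_def)
  have injh: "inj_on h (\<phi> ` J)"
    using inj\<kappa> by (auto simp: inj_on_def h)
  let ?hom = "\<lparr> iso_verts = h, iso_arcs = map_prod h h, iso_head = snd, iso_tail = fst \<rparr>"
  have K: "verts ?K = \<phi> ` J" "arcs ?K = {e \<in> parcs G. fst e \<in> \<phi> ` J \<and> snd e \<in> \<phi> ` J}"
    "tail ?K = fst" "head ?K = snd"
    by (auto simp: with_proj_def induce_subgraph_def)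
  have wf: "wf_digraph ?K" unfolding wf_digraph_def K by auto
  have "pre_digraph.digraph_isomorphism ?K ?hom"
    unfolding pre_digraph.digraph_isomorphism_def K
    using wf injh by (auto simp: inj_on_def)
  moreover have "map_prod h h ` {e \<in> parcs G. fst e \<in> \<phi> ` J \<and> snd e \<in> \<phi> ` J} = parcs H"
  proof
    show "map_prod h h ` {e \<in> parcs G. fst e \<in> \<phi> ` J \<and> snd e \<in> \<phi> ` J} \<subseteq> parcs H"
      using arcs by (auto simp: h)
    show "parcs H \<subseteq> map_prod h h ` {e \<in> parcs G. fst e \<in> \<phi> ` J \<and> snd e \<in> \<phi> ` J}"
    proof
      fix e assume e: "e \<in> parcs H"
      then have "fst e \<in> \<kappa> ` J" "snd e \<in> \<kappa> ` J" using H unfolding im\<kappa> by auto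
      then obtain i j where ij: "i \<in> J" "j \<in> J" "fst e = \<kappa> i" "snd e = \<kappa> j" by auto
      then have e': "e = (\<kappa> i, \<kappa> j)" by (simp add: prod_eq_iff)
      then have "(\<phi> i, \<phi> j) \<in> parcs G" using arcs[OF ij(1,2)] e by simp
      moreover have "e = map_prod h h (\<phi> i, \<phi> j)" using ij(1,2) e' h by simp
      ultimately show "e \<in> map_prod h h ` {e \<in> parcs G. fst e \<in> \<phi> ` J \<and> snd e \<in> \<phi> ` J}"
        using ij(1,2) by (intro image_eqI[of _ _ "(\<phi> i, \<phi> j)"]) auto
    qed
  qed
  moreover have "h ` \<phi> ` J = pverts H" unfolding im\<kappa>[symmetric] image_image
    using h by (intro image_cong) auto
  ultimately have "digraph_iso ?K (with_proj H)"
    unfolding digraph_iso_def app_iso_def K with_proj_def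
    by (intro exI[of _ ?hom]) (simp add: with_proj_def)
  with ind show ?thesis unfolding contains_induced_def by blast
qed

text \<open>The number that \<^const>\<open>S_graph\<close> gives to the vertex at distance \<open>s\<close> from the
  centre on leg \<open>l < 3\<close>.\<close>
definition leg_vertex :: "nat \<Rightarrow> nat \<Rightarrow> nat \<Rightarrow> nat" where
  "leg_vertex p l s = (if s = 0 then 0 else 3 * (p - s) + l + 1)"

section \<open>Coordinates on the legs of the subdivided claw\<close>

lemma three_mult_add_eq_iff:
  fixes a b l l' :: nat
  assumes "l < 3" "l' < 3"
  shows "3 * a + l = 3 * b + l' \<longleftrightarrow> a = b \<and> l = l'"
proof
  assume eq: "3 * a + l = 3 * b + l'"
  have "(3 * a + l) div 3 = a" "(3 * b + l') div 3 = b" using assms by simp_all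
  with eq have "a = b" by simp
  with eq show "a = b \<and> l = l'" by simp
qed simp

lemma leg_vertex_eq_iff:
  assumes "l < 3" "l' < 3" "s \<le> p" "s' \<le> p"
  shows "leg_vertex p l s = leg_vertex p l' s' \<longleftrightarrow> s = s' \<and> (s = 0 \<or> l = l')"
proof (cases "s = 0 \<or> s' = 0")
  case True
  then show ?thesis by (auto simp: leg_vertex_def)
next
  case False
  then have "leg_vertex p l s = leg_vertex p l' s' \<longleftrightarrow> 3 * (p - s) + l = 3 * (p - s') + l'"
    by (simp add: leg_vertex_def)
  also have "\<dots> \<longleftrightarrow> p - s = p - s' \<and> l = l'" by (rule three_mult_add_eq_iff[OF assms(1,2)])
  also have "p - s = p - s' \<longleftrightarrow> s = s'" using assms(3,4) by linarith
  finally show ?thesis using False by blast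
qed

lemma S_graph_arc_iff:
  "(x, y) \<in> parcs (S_graph (Suc k)) \<longleftrightarrow>
     x = 0 \<and> 3*k + 1 \<le> y \<and> y \<le> 3*k + 3 \<or> y = 0 \<and> 3*k + 1 \<le> x \<and> x \<le> 3*k + 3 \<or>
     1 \<le> y \<and> y \<le> 3*k \<and> x = y + 3 \<or> 1 \<le> x \<and> x \<le> 3*k \<and> y = x + 3"
  by (simp add: S_graph_def subdivided_claw_explicit(2))

lemma leg_vertex_arc_iff:
  assumes "l < 3" "l' < 3" "s \<le> p" "s' \<le> p" "p \<ge> 1"
  shows "(leg_vertex p l s, leg_vertex p l' s') \<in> parcs (S_graph p) \<longleftrightarrow>
    (l = l' \<or> s = 0 \<or> s' = 0) \<and> (s' = Suc s \<or> s = Suc s')"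
proof -
  obtain k where k: "p = Suc k" using assms(5) by (cases p) auto
  have centre: "3*k + 1 \<le> leg_vertex p l s \<and> leg_vertex p l s \<le> 3*k + 3 \<longleftrightarrow> s = 1"
    if "0 < s" "s \<le> p" "l < 3" for l s
    using that k by (cases "s = 1") (auto simp: leg_vertex_def)
  \<comment> \<open>Along a leg the number falls by 3 with each step away from the centre.\<close>
  have leg: "1 \<le> leg_vertex p l' s' \<and> leg_vertex p l' s' \<le> 3*k \<and> leg_vertex p l s = leg_vertex p l' s' + 3
      \<longleftrightarrow> l = l' \<and> s' = Suc s"
    if "0 < s" "0 < s'" "s \<le> p" "s' \<le> p" "l < 3" "l' < 3" for l l' s s'
  proof -
    have "leg_vertex p l s = leg_vertex p l' s' + 3 \<longleftrightarrow> 3 * (p - s) + l = 3 * Suc (p - s') + l'"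
      using that by (auto simp: leg_vertex_def)
    also have "\<dots> \<longleftrightarrow> p - s = Suc (p - s') \<and> l = l'" by (rule three_mult_add_eq_iff[OF that(5,6)])
    also have "p - s = Suc (p - s') \<longleftrightarrow> s' = Suc s" using that(3,4) by linarith
    finally show ?thesis using that k by (auto simp: leg_vertex_def)
  qed
  have pos: "leg_vertex p l s = 0 \<longleftrightarrow> s = 0" for l s by (simp add: leg_vertex_def)
  consider "s = 0" "s' = 0" | "s = 0" "0 < s'" | "0 < s" "s' = 0" | "0 < s" "0 < s'" by blast
  then show ?thesis
  proof cases
    case 1
    then show ?thesis by (simp add: k S_graph_arc_iff leg_vertex_def)
  next
    case 2
    then have "(leg_vertex p l s, leg_vertex p l' s') \<in> parcs (S_graph p) \<longleftrightarrow>
        3*k + 1 \<le> leg_vertex p l' s' \<and> leg_vertex p l' s' \<le> 3*k + 3"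
      by (auto simp: k S_graph_arc_iff leg_vertex_def)
    then show ?thesis using centre[of s' l'] 2 assms by simp
  next
    case 3
    then have "(leg_vertex p l s, leg_vertex p l' s') \<in> parcs (S_graph p) \<longleftrightarrow>
        3*k + 1 \<le> leg_vertex p l s \<and> leg_vertex p l s \<le> 3*k + 3"
      by (auto simp: k S_graph_arc_iff leg_vertex_def)
    then show ?thesis using centre[of s l] 3 assms by simp
  next
    case 4
    have "(leg_vertex p l s, leg_vertex p l' s') \<in> parcs (S_graph p) \<longleftrightarrow>
        l = l' \<and> s' = Suc s \<or> l' = l \<and> s = Suc s'"
      unfolding leg[OF 4 assms(3,4,1,2), symmetric] leg[OF 4(2,1) assms(4,3,2,1), symmetric]
      unfolding k S_graph_arc_iff using pos 4 by (simp add: k)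
    then show ?thesis using 4 by blast
  qed
qed

lemma leg_vertex_cases:
  assumes "v \<in> pverts (S_graph p)" "p \<ge> 1"
  obtains l s where "l < 3" "s \<le> p" "v = leg_vertex p l s"
proof (cases "v = 0")
  case True
  then show ?thesis using that[of 0 0] by (simp add: leg_vertex_def)
next
  case False
  have v: "v \<le> 3 * p" using assms by (simp add: S_graph_def subdivided_claw_explicit(1))
  \<comment> \<open>Inverts the numbering: \<open>v - 1\<close> is
    \<open>3 * (p - s) + l\<close>.\<close>
  let ?l = "(v - 1) mod 3" and ?s = "p - (v - 1) div 3"
  have "(v - 1) div 3 < p" using False v by presburger
  then have "v = leg_vertex p ?l ?s" using False by (simp add: leg_vertex_def)
  then show ?thesis using that[of ?l ?s] by simp
qed

lemma S_graph_arcs_subset: "p \<ge> 1 \<Longrightarrow> parcs (S_graph p) \<subseteq> pverts (S_graph p) \<times> pverts (S_graph p)"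
  by (auto simp: S_graph_def subdivided_claw_explicit)

lemma leg_vertex_in_verts: "l < 3 \<Longrightarrow> s \<le> p \<Longrightarrow> p \<ge> 1 \<Longrightarrow> leg_vertex p l s \<in> pverts (S_graph p)"
  by (auto simp: leg_vertex_def S_graph_def subdivided_claw_explicit(1))

text \<open>An edge is named by its outer end, so \<open>s\<close> runs from 1 to \<open>p\<close>;
  the three edges with \<open>s = 1\<close> share the centre and form the triangle of
  \<open>T_graph p\<close>.\<close>

definition leg_edge :: "nat \<Rightarrow> nat \<Rightarrow> nat \<Rightarrow> nat set" where
  "leg_edge p l s = {leg_vertex p l (s - 1), leg_vertex p l s}"

lemma edges_S_graph:
  assumes "p \<ge> 1"
  shows "edges (S_graph p) = {leg_edge p l s |l s. l < 3 \<and> 1 \<le> s \<and> s \<le> p}"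
proof (intro equalityI subsetI)
  fix e assume "e \<in> edges (S_graph p)"
  then obtain u v where uv: "e = {u, v}" "(u, v) \<in> parcs (S_graph p)" by (auto simp: edges_def)
  then have "u \<in> pverts (S_graph p)" "v \<in> pverts (S_graph p)"
    using S_graph_arcs_subset[OF assms] by auto
  then obtain l s l' s' where ls: "l < 3" "s \<le> p" "u = leg_vertex p l s"
    "l' < 3" "s' \<le> p" "v = leg_vertex p l' s'"
    using leg_vertex_cases[OF _ assms] by metis
  then have arc: "(l = l' \<or> s = 0 \<or> s' = 0) \<and> (s' = Suc s \<or> s = Suc s')"
    using uv(2) leg_vertex_arc_iff[of l l' s p s'] assms by blast
  show "e \<in> {leg_edge p l s |l s. l < 3 \<and> 1 \<le> s \<and> s \<le> p}"
  proof (cases "s' = Suc s")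
    case True
    then have "u = leg_vertex p l' s" using arc ls by (auto simp: leg_vertex_def)
    then have "e = leg_edge p l' s'" using uv ls True by (auto simp: leg_edge_def)
    then show ?thesis using ls True by auto
  next
    case False
    then have "s = Suc s'" using arc by blast
    moreover from this have "v = leg_vertex p l s'" using arc ls by (auto simp: leg_vertex_def)
    ultimately have "e = leg_edge p l s" using uv ls by (auto simp: leg_edge_def)
    then show ?thesis using ls \<open>s = Suc s'\<close> by auto
  qed
next
  fix e assume "e \<in> {leg_edge p l s |l s. l < 3 \<and> 1 \<le> s \<and> s \<le> p}"
  then obtain l s where ls: "e = leg_edge p l s" "l < 3" "1 \<le> s" "s \<le> p" by blast
  then have "(leg_vertex p l (s - 1), leg_vertex p l s) \<in> parcs (S_graph p)"
    using leg_vertex_arc_iff[of l l "s - 1" p s] assms by simp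
  then show "e \<in> edges (S_graph p)" unfolding ls(1) leg_edge_def edges_def by blast
qed

lemma leg_edge_eq_iff:
  assumes "l < 3" "l' < 3" "1 \<le> s" "1 \<le> s'" "s \<le> p" "s' \<le> p"
  shows "leg_edge p l s = leg_edge p l' s' \<longleftrightarrow> l = l' \<and> s = s'"
proof -
  have "s - 1 \<le> p" "s' - 1 \<le> p" using assms by auto
  then show ?thesis
    using assms unfolding leg_edge_def doubleton_eq_iff by (auto simp: leg_vertex_eq_iff)
qed

lemma leg_edge_Int_iff:
  assumes "l < 3" "l' < 3" "1 \<le> s" "1 \<le> s'" "s \<le> p" "s' \<le> p"
  shows "leg_edge p l s \<noteq> leg_edge p l' s' \<and> leg_edge p l s \<inter> leg_edge p l' s' \<noteq> {} \<longleftrightarrow>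
    l = l' \<and> (s' = Suc s \<or> s = Suc s') \<or> l \<noteq> l' \<and> s = 1 \<and> s' = 1"
proof -
  have le: "s - 1 \<le> p" "s' - 1 \<le> p" using assms by auto
  have "leg_edge p l s \<inter> leg_edge p l' s' \<noteq> {} \<longleftrightarrow>
    leg_vertex p l (s - 1) = leg_vertex p l' (s' - 1) \<or> leg_vertex p l (s - 1) = leg_vertex p l' s' \<or>
    leg_vertex p l s = leg_vertex p l' (s' - 1) \<or> leg_vertex p l s = leg_vertex p l' s'"
    unfolding leg_edge_def by auto
  then show ?thesis
    using assms(3,4)
    unfolding leg_edge_eq_iff[OF assms] leg_vertex_eq_iff[OF assms(1,2) le]
      leg_vertex_eq_iff[OF assms(1,2) le(1) assms(6)]
      leg_vertex_eq_iff[OF assms(1,2) assms(5) le(2)]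
      leg_vertex_eq_iff[OF assms(1,2,5,6)]
    by (cases s; cases s') auto
qed

section \<open>Recognising the two forbidden graphs by coordinates\<close>

context pair_graph
begin

lemma contains_S_graphI:
  fixes g :: "nat \<Rightarrow> nat \<Rightarrow> 'a"
  assumes p: "p \<ge> 1"
    and V: "\<And>l s. l < 3 \<Longrightarrow> s \<le> p \<Longrightarrow> g l s \<in> pverts G"
    and eq: "\<And>l s l' s'. l < 3 \<Longrightarrow> l' < 3 \<Longrightarrow> s \<le> p \<Longrightarrow> s' \<le> p \<Longrightarrow>
      g l s = g l' s' \<longleftrightarrow> s = s' \<and> (s = 0 \<or> l = l')"
    and arc: "\<And>l s l' s'. l < 3 \<Longrightarrow> l' < 3 \<Longrightarrow> s \<le> p \<Longrightarrow> s' \<le> p \<Longrightarrow>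
      (g l s, g l' s') \<in> parcs G \<longleftrightarrow> (l = l' \<or> s = 0 \<or> s' = 0) \<and> (s' = Suc s \<or> s = Suc s')"
  shows "contains_induced (with_proj G) (with_proj (S_graph p))"
proof (rule contains_inducedI)
  \<comment> \<open>The centre has three names \<open>(l, 0)\<close>; only \<open>(0, 0)\<close> is
    kept, so that naming is injective.\<close>
  let ?J = "{(l, s). l < 3 \<and> s \<le> p \<and> (s = 0 \<longrightarrow> l = 0)}"
  show "inj_on (\<lambda>(l, s). g l s) ?J"
    by (auto simp: inj_on_def eq)
  show "(\<lambda>(l, s). g l s) ` ?J \<subseteq> pverts G" using V by auto
  show "parcs (S_graph p) \<subseteq> pverts (S_graph p) \<times> pverts (S_graph p)"
    by (rule S_graph_arcs_subset[OF p])
  show "bij_betw (\<lambda>(l, s). leg_vertex p l s) ?J (pverts (S_graph p))"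
    unfolding bij_betw_def
  proof
    show "inj_on (\<lambda>(l, s). leg_vertex p l s) ?J"
      by (auto simp: inj_on_def leg_vertex_eq_iff)
    show "(\<lambda>(l, s). leg_vertex p l s) ` ?J = pverts (S_graph p)"
    proof (intro equalityI subsetI)
      fix v assume "v \<in> pverts (S_graph p)"
      then obtain l s where ls: "l < 3" "s \<le> p" "v = leg_vertex p l s"
        using leg_vertex_cases p by blast
      then have "v = leg_vertex p (if s = 0 then 0 else l) s" by (simp add: leg_vertex_def)
      then show "v \<in> (\<lambda>(l, s). leg_vertex p l s) ` ?J"
        using ls by (intro image_eqI[of _ _ "(if s = 0 then 0 else l, s)"]) auto
    qed (auto intro: leg_vertex_in_verts p)
  qed
  show "((\<lambda>(l, s). g l s) i, (\<lambda>(l, s). g l s) j) \<in> parcs G \<longleftrightarrow>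
      ((\<lambda>(l, s). leg_vertex p l s) i, (\<lambda>(l, s). leg_vertex p l s) j) \<in> parcs (S_graph p)"
    if "i \<in> ?J" "j \<in> ?J" for i j
    using that p by (cases i; cases j) (simp add: arc leg_vertex_arc_iff)
qed

lemma contains_T_graphI:
  fixes g :: "nat \<Rightarrow> nat \<Rightarrow> 'a"
  assumes p: "p \<ge> 1"
    and V: "\<And>l s. l < 3 \<Longrightarrow> 1 \<le> s \<Longrightarrow> s \<le> p \<Longrightarrow> g l s \<in> pverts G"
    and eq: "\<And>l s l' s'. l < 3 \<Longrightarrow> l' < 3 \<Longrightarrow> 1 \<le> s \<Longrightarrow> 1 \<le> s' \<Longrightarrow> s \<le> p \<Longrightarrow> s' \<le> p \<Longrightarrow>
      g l s = g l' s' \<longleftrightarrow> l = l' \<and> s = s'"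
    and arc: "\<And>l s l' s'. l < 3 \<Longrightarrow> l' < 3 \<Longrightarrow> 1 \<le> s \<Longrightarrow> 1 \<le> s' \<Longrightarrow> s \<le> p \<Longrightarrow> s' \<le> p \<Longrightarrow>
      (g l s, g l' s') \<in> parcs G \<longleftrightarrow>
      l = l' \<and> (s' = Suc s \<or> s = Suc s') \<or> l \<noteq> l' \<and> s = 1 \<and> s' = 1"
  shows "contains_induced (with_proj G) (with_proj (T_graph p))"
proof (rule contains_inducedI)
  let ?J = "{(l, s). l < 3 \<and> 1 \<le> s \<and> s \<le> p}"
  have T: "pverts (T_graph p) = edges (S_graph p)"
    "parcs (T_graph p) = {(e, f). e \<in> edges (S_graph p) \<and> f \<in> edges (S_graph p) \<and> e \<noteq> f \<and> e \<inter> f \<noteq> {}}"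
    by (auto simp: T_graph_def line_graph_def)
  show "inj_on (\<lambda>(l, s). g l s) ?J"
    by (auto simp: inj_on_def eq)
  show "(\<lambda>(l, s). g l s) ` ?J \<subseteq> pverts G" using V by auto
  show "parcs (T_graph p) \<subseteq> pverts (T_graph p) \<times> pverts (T_graph p)"
    unfolding T by auto
  show "bij_betw (\<lambda>(l, s). leg_edge p l s) ?J (pverts (T_graph p))"
    unfolding bij_betw_def
  proof
    show "inj_on (\<lambda>(l, s). leg_edge p l s) ?J"
      by (auto simp: inj_on_def leg_edge_eq_iff)
    show "(\<lambda>(l, s). leg_edge p l s) ` ?J = pverts (T_graph p)"
      unfolding T edges_S_graph[OF p] by auto
  qed
  show "((\<lambda>(l, s). g l s) i, (\<lambda>(l, s). g l s) j) \<in> parcs G \<longleftrightarrow>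
      ((\<lambda>(l, s). leg_edge p l s) i, (\<lambda>(l, s). leg_edge p l s) j) \<in> parcs (T_graph p)"
    if "i \<in> ?J" "j \<in> ?J" for i j
  proof -
    obtain l s l' s' where ij: "i = (l, s)" "j = (l', s')" by fastforce
    have b: "l < 3" "l' < 3" "1 \<le> s" "1 \<le> s'" "s \<le> p" "s' \<le> p" using that ij by auto
    then have "leg_edge p l s \<in> edges (S_graph p)" "leg_edge p l' s' \<in> edges (S_graph p)"
      unfolding edges_S_graph[OF p] by blast+
    then have "(leg_edge p l s, leg_edge p l' s') \<in> parcs (T_graph p) \<longleftrightarrow>
        leg_edge p l s \<noteq> leg_edge p l' s' \<and> leg_edge p l s \<inter> leg_edge p l' s' \<noteq> {}"
      unfolding T by simp
    then show ?thesis unfolding ij leg_edge_Int_iff[OF b] using arc[OF b] by simp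
  qed
qed

text \<open>With \<open>i\<close> and \<open>j\<close> the first and last neighbour of \<open>f 0\<close> on the path \<open>q\<close>: if \<open>i = j\<close>, the centre is
  \<open>q i\<close>; if \<open>j = i + 1\<close>, the triangle is \<open>f 0\<close>, \<open>q i\<close>, \<open>q j\<close>; otherwise the centre is \<open>f 0\<close>.\<close>
lemma contains_S_or_T_graph:
  assumes p: "p \<ge> 1"
    and qV: "\<And>a. a < m \<Longrightarrow> q a \<in> pverts G"
    and q_eq: "\<And>a b. a < m \<Longrightarrow> b < m \<Longrightarrow> q a = q b \<longleftrightarrow> a = b"
    and q_arc: "\<And>a b. a < m \<Longrightarrow> b < m \<Longrightarrow> (q a, q b) \<in> parcs G \<longleftrightarrow> b = Suc a \<or> a = Suc b"
    and fV: "\<And>t. t \<le> p \<Longrightarrow> f t \<in> pverts G"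
    and f_eq: "\<And>t u. t \<le> p \<Longrightarrow> u \<le> p \<Longrightarrow> f t = f u \<longleftrightarrow> t = u"
    and f_arc: "\<And>t u. t \<le> p \<Longrightarrow> u \<le> p \<Longrightarrow> (f t, f u) \<in> parcs G \<longleftrightarrow> u = Suc t \<or> t = Suc u"
    and fq: "\<And>t a. t \<le> p \<Longrightarrow> a < m \<Longrightarrow> f t \<noteq> q a"
    and fq_arc: "\<And>t a. 0 < t \<Longrightarrow> t \<le> p \<Longrightarrow> a < m \<Longrightarrow> (f t, q a) \<notin> parcs G"
    and i: "p \<le> i" "(f 0, q i) \<in> parcs G" and j: "j + p < m" "(f 0, q j) \<in> parcs G"
    and ij: "\<And>a. a < m \<Longrightarrow> (f 0, q a) \<in> parcs G \<Longrightarrow> i \<le> a \<and> a \<le> j"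
  shows "contains_induced (with_proj G) (with_proj (S_graph p)) \<or>
    contains_induced (with_proj G) (with_proj (T_graph p))"
proof -
  have ilej: "i \<le> j" using ij[of j] j by simp
  have qf_arc: "(q a, f t) \<in> parcs G \<longleftrightarrow> (f t, q a) \<in> parcs G" for a t
    using arc_sym by blast
  note [simp] = qV q_eq q_arc fV f_eq f_arc fq fq[symmetric] fq_arc qf_arc
  have [simp]: "f t \<noteq> q a" "q a \<noteq> f t" if "t \<le> p" "a < m" for t a
    using fq[OF that] by auto
  have below: "(f 0, q a) \<notin> parcs G" if "a < i" for a
    using ij[of a] that ilej j(1) by auto
  have above: "(f 0, q a) \<notin> parcs G" if "j < a" "a < m" for a
    using ij[of a] that by auto
  have three: "l = 0 \<or> l = 1 \<or> l = 2" if "l < 3" for l :: nat using that by auto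
  consider "i = j" | "j = Suc i" | "Suc i < j" using ilej by linarith
  then show ?thesis
  proof cases
    case 1
    \<comment> \<open>With centre \<open>q i\<close> the vertex \<open>f 0\<close> is already at
      distance 1, hence the shift on leg 0. The other legs follow the path in both directions, with
      room for \<open>p\<close> steps each way.\<close>
    define g where "g l s = (if s = 0 then q i else if l = (0::nat) then f (s - 1)
      else if l = 1 then q (i - s) else q (i + s))" for l s
    have fi: "(f t, q a) \<in> parcs G \<longleftrightarrow> t = 0 \<and> a = i" if "t \<le> p" "a < m" for t a
      using that below[of a] above[of a] i j 1 by (cases "t = 0"; cases a i rule: linorder_cases) auto
    have "contains_induced (with_proj G) (with_proj (S_graph p))"
    proof (rule contains_S_graphI[OF p, of g])
      show "g l s \<in> pverts G" if "l < 3" "s \<le> p" for l s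
        using that i(1) j(1) 1 by (auto simp: g_def)
      fix l s l' s' :: nat assume b: "l < 3" "l' < 3" "s \<le> p" "s' \<le> p"
      show "g l s = g l' s' \<longleftrightarrow> s = s' \<and> (s = 0 \<or> l = l')"
        using three[OF b(1)] three[OF b(2)] b(3,4) i(1) j(1) 1 by (elim disjE) (auto simp: g_def)
      show "(g l s, g l' s') \<in> parcs G \<longleftrightarrow> (l = l' \<or> s = 0 \<or> s' = 0) \<and> (s' = Suc s \<or> s = Suc s')"
        using three[OF b(1)] three[OF b(2)] b(3,4) i(1) j(1) 1
        by (elim disjE) (auto simp: g_def fi)
    qed
    then show ?thesis ..
  next
    case 2
    \<comment> \<open>At \<open>s = 1\<close> the three legs start in the triangle
      \<open>f 0\<close>, \<open>q i\<close>, \<open>q j\<close>.\<close>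
    define g where "g l s = (if l = (0::nat) then f (s - 1)
      else if l = 1 then q (i + 1 - s) else q (j + s - 1))" for l s
    have fi: "(f t, q a) \<in> parcs G \<longleftrightarrow> t = 0 \<and> (a = i \<or> a = j)" if "t \<le> p" "a < m" for t a
      using that below[of a] above[of a] i j 2
      by (cases "t = 0"; cases a j rule: linorder_cases) (auto simp: less_Suc_eq)
    have "contains_induced (with_proj G) (with_proj (T_graph p))"
    proof (rule contains_T_graphI[OF p, of g])
      show "g l s \<in> pverts G" if "l < 3" "1 \<le> s" "s \<le> p" for l s
        using that i(1) j(1) 2 by (auto simp: g_def)
      fix l s l' s' :: nat assume b: "l < 3" "l' < 3" "1 \<le> s" "1 \<le> s'" "s \<le> p" "s' \<le> p"
      show "g l s = g l' s' \<longleftrightarrow> l = l' \<and> s = s'"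
        using three[OF b(1)] three[OF b(2)] b(3-) i(1) j(1) 2 by (elim disjE) (auto simp: g_def)
      show "(g l s, g l' s') \<in> parcs G \<longleftrightarrow>
          l = l' \<and> (s' = Suc s \<or> s = Suc s') \<or> l \<noteq> l' \<and> s = 1 \<and> s' = 1"
        using three[OF b(1)] three[OF b(2)] b(3-) i(1) j(1) 2
        by (elim disjE) (auto simp: g_def fi)
    qed
    then show ?thesis ..
  next
    case 3
    define g where "g l s = (if s = 0 then f 0 else if l = (0::nat) then f s
      else if l = 1 then q (i + 1 - s) else q (j + s - 1))" for l s
    \<comment> \<open>Strictly between \<open>i\<close> and \<open>j\<close> the path may hold
      further neighbours of \<open>f 0\<close>, but the legs run outwards from \<open>q i\<close>
      and \<open>q j\<close> and avoid that stretch.\<close>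
    have fi: "(f t, q a) \<in> parcs G \<longleftrightarrow> t = 0 \<and> (a = i \<or> a = j)"
      if "t \<le> p" "a < m" "a \<le> i \<or> j \<le> a" for t a
      using that below[of a] above[of a] i j by (cases "t = 0") (auto simp: le_less)
    have "contains_induced (with_proj G) (with_proj (S_graph p))"
    proof (rule contains_S_graphI[OF p, of g])
      show "g l s \<in> pverts G" if "l < 3" "s \<le> p" for l s
        using that i(1) j(1) 3 by (auto simp: g_def)
      fix l s l' s' :: nat assume b: "l < 3" "l' < 3" "s \<le> p" "s' \<le> p"
      show "g l s = g l' s' \<longleftrightarrow> s = s' \<and> (s = 0 \<or> l = l')"
        using three[OF b(1)] three[OF b(2)] b(3,4) i(1) j(1) 3 by (elim disjE) (auto simp: g_def)
      show "(g l s, g l' s') \<in> parcs G \<longleftrightarrow> (l = l' \<or> s = 0 \<or> s' = 0) \<and> (s' = Suc s \<or> s = Suc s')"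
        using three[OF b(1)] three[OF b(2)] b(3,4) i(1) j(1) 3
        by (elim disjE; cases s; cases s') (auto simp: g_def fi)
    qed
    then show ?thesis ..
  qed
qed

end

section \<open>Gyarfas paths\<close>

definition closed_nbhd :: "'a pair_pre_digraph \<Rightarrow> 'a set \<Rightarrow> 'a set" where
  "closed_nbhd G Y = Y \<union> {v. \<exists>y\<in>Y. (y, v) \<in> parcs G}"

text \<open>A witness that \<open>closed_nbhd G Y\<close> is not balanced for \<open>I\<close>.
  Strictly more than half of \<open>I\<close> is required so that any two heavy components
  meet.\<close>

definition heavy_component :: "'a pair_pre_digraph \<Rightarrow> 'a set \<Rightarrow> 'a set \<Rightarrow> 'a set \<Rightarrow> bool" where
  "heavy_component G I Y D \<longleftrightarrow>
     component G (pverts G - closed_nbhd G Y) D \<and> card I < 2 * card (I \<inter> D)"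

text \<open>Paths are lists that grow at the head: the newest vertex comes first.\<close>

definition induced_path :: "'a pair_pre_digraph \<Rightarrow> 'a list \<Rightarrow> bool" where
  "induced_path G xs \<longleftrightarrow> set xs \<subseteq> pverts G \<and> distinct xs \<and>
     (\<forall>i<length xs. \<forall>j<length xs. (xs ! i, xs ! j) \<in> parcs G \<longleftrightarrow> j = Suc i \<or> i = Suc j)"

lemma closed_nbhd_Un: "closed_nbhd G (A \<union> B) = closed_nbhd G A \<union> closed_nbhd G B"
  by (auto simp: closed_nbhd_def)

lemma closed_nbhd_insert: "closed_nbhd G (insert h Y) = closed_nbhd G {h} \<union> closed_nbhd G Y"
  by (auto simp: closed_nbhd_def)

lemma closed_nbhd_mono: "A \<subseteq> B \<Longrightarrow> closed_nbhd G A \<subseteq> closed_nbhd G B"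
  by (auto simp: closed_nbhd_def)

lemma closed_nbhd_self: "A \<subseteq> closed_nbhd G A"
  by (auto simp: closed_nbhd_def)

lemma heavy_meet:
  assumes "finite I" "card I < 2 * card (I \<inter> C)" "card I < 2 * card (I \<inter> D)"
  shows "C \<inter> D \<noteq> {}"
proof
  assume "C \<inter> D = {}"
  then have "card (I \<inter> C \<union> I \<inter> D) = card (I \<inter> C) + card (I \<inter> D)"
    using assms(1) by (intro card_Un_disjoint) auto
  moreover have "card (I \<inter> C \<union> I \<inter> D) \<le> card I"
    using assms(1) by (intro card_mono) auto
  ultimately show False using assms(2,3) by linarith
qed

lemma heavy_componentD:
  assumes "heavy_component G I Y C"
  shows "C \<subseteq> pverts G" "C \<inter> closed_nbhd G Y = {}" "C \<noteq> {}" "linked G C"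
    "\<And>a b. a \<in> C \<Longrightarrow> b \<in> pverts G \<Longrightarrow> b \<notin> closed_nbhd G Y \<Longrightarrow> (a, b) \<in> parcs G \<Longrightarrow> b \<in> C"
    "card I < 2 * card (I \<inter> C)"
  using assms unfolding heavy_component_def component_def by auto

text \<open>Up to length \<open>2 * p\<close> the ends are the whole list, so short paths need no
  separate treatment.\<close>

definition ends :: "nat \<Rightarrow> 'b list \<Rightarrow> 'b set" where
  "ends p xs = set (take p xs) \<union> set (take p (rev xs))"

lemma ends_subset: "ends p xs \<subseteq> set xs"
  unfolding ends_def using set_take_subset[of p xs] set_take_subset[of p "rev xs"] by auto

lemma card_ends: "card (ends p xs) \<le> 2 * p"
proof -
  have "card (ends p xs) \<le> card (set (take p xs)) + card (set (take p (rev xs)))"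
    unfolding ends_def by (rule card_Un_le)
  also have "\<dots> \<le> length (take p xs) + length (take p (rev xs))"
    by (intro add_mono card_length)
  also have "\<dots> \<le> 2 * p" by simp
  finally show ?thesis .
qed

text \<open>A longer path has no end vertices besides its new head and the old ends, so a component
  avoiding the neighbourhoods of these also avoids that of the new ends.\<close>

lemma ends_Cons_subset: "ends p (h # t) \<subseteq> insert h (ends p t)"
proof -
  have "set (take p (h # t)) \<subseteq> insert h (set (take p t))"
    using set_take_subset_set_take[of "p - 1" p t] by (cases p) auto
  moreover have "set (take p (rev (h # t))) \<subseteq> insert h (set (take p (rev t)))"
    by (auto dest: in_set_takeD)
  ultimately show ?thesis unfolding ends_def by blast
qed

lemma nth_in_ends:
  assumes "a < length xs" "a < p \<or> length xs \<le> a + p"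
  shows "xs ! a \<in> ends p xs"
  using assms(2)
proof
  assume "a < p"
  then have "xs ! a \<in> set (take p xs)" using assms(1) by (auto simp: in_set_conv_nth)
  then show ?thesis by (simp add: ends_def)
next
  assume "length xs \<le> a + p"
  then have "rev xs ! (length xs - 1 - a) \<in> set (take p (rev xs))"
    using assms(1) by (auto simp: in_set_conv_nth intro!: exI[of _ "length xs - 1 - a"])
  then show ?thesis using assms(1) by (simp add: ends_def rev_nth)
qed

section \<open>Growing induced paths towards the heavy component\<close>

context pair_graph
begin

lemma induced_path_Cons:
  assumes path: "induced_path G (h # t)" and b: "(h, b) \<in> parcs G" "b \<notin> closed_nbhd G (set t)"
  shows "induced_path G (b # h # t)"
proof -
  have "b \<noteq> h" using b(1) arc_irrefl by blast
  have bt: "b \<notin> set t" "\<And>y. y \<in> set t \<Longrightarrow> (y, b) \<notin> parcs G"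
    using b(2) by (auto simp: closed_nbhd_def)
  have bt': "(b, y) \<notin> parcs G" if "y \<in> set t" for y using bt(2)[OF that] arc_sym by blast
  have hb: "(b, h) \<in> parcs G" using b(1) by (rule arc_sym)
  have "((b # h # t) ! i, (b # h # t) ! j) \<in> parcs G \<longleftrightarrow> j = Suc i \<or> i = Suc j"
    if ij: "i < length (b # h # t)" "j < length (b # h # t)" for i j
  proof -
    consider "i = 0" "j = 0" | j' where "i = 0" "j = Suc j'" | i' where "i = Suc i'" "j = 0" |
      i' j' where "i = Suc i'" "j = Suc j'" by (metis not0_implies_Suc)
    then show ?thesis
    proof cases
      case 1
      then show ?thesis using arc_irrefl by simp
    next
      case (2 j')
      then show ?thesis using b(1) hb bt' ij by (cases j') auto
    next
      case (3 i')
      then show ?thesis using b(1) hb bt ij by (cases i') auto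
    next
      case (4 i' j')
      then show ?thesis using path ij unfolding induced_path_def by auto
    qed
  qed
  then show ?thesis
    using path \<open>b \<noteq> h\<close> bt(1) in_arcsD2[OF b(1)] unfolding induced_path_def by simp
qed

text \<open>One step of Gyarfas' argument. The heavy components \<open>C\<close> and
  \<open>C'\<close> meet, so \<open>C'\<close> lies in \<open>C\<close>, properly because
  \<open>C\<close> meets the neighbourhood of \<open>h\<close>. An arc of \<open>C\<close> leaving
  \<open>C'\<close> ends in some \<open>b\<close> that only the removal of that neighbourhood can
  have cut off; \<open>b\<close> prolongs the path.\<close>

lemma heavy_component_insert:
  assumes I: "finite I" and C: "heavy_component G I Y C" and h: "closed_nbhd G {h} \<inter> C \<noteq> {}"
    and C': "heavy_component G I (insert h Y) C'"
  obtains b where "C' \<subseteq> C" "C' \<inter> closed_nbhd G {h} = {}" "b \<in> C" "(h, b) \<in> parcs G"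
    "closed_nbhd G {b} \<inter> C' \<noteq> {}"
proof -
  note CD = heavy_componentD[OF C] and CD' = heavy_componentD[OF C']
  have Ch: "C' \<inter> closed_nbhd G {h} = {}"
    using CD'(2) unfolding closed_nbhd_insert[of G h Y] by blast
  have meet: "C' \<inter> C \<noteq> {}" by (rule heavy_meet[OF I CD'(6) CD(6)])
  have "C' \<subseteq> pverts G - closed_nbhd G Y"
    using CD'(1,2) unfolding closed_nbhd_insert[of G h Y] by blast
  then have sub: "C' \<subseteq> C"
    using linked_subset_component[OF CD'(4) _ _ meet] C unfolding heavy_component_def by blast
  have "C' \<inter> C \<noteq> {}" "C - C' \<noteq> {}" using meet h Ch by blast+
  then obtain a b where ab: "a \<in> C \<inter> C'" "b \<in> C - C'" "(a, b) \<in> parcs G"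
    using CD(4) unfolding linked_def by blast
  have "b \<in> pverts G" "b \<notin> closed_nbhd G Y" using ab(2) CD(1,2) by blast+
  then have "b \<in> closed_nbhd G {h}"
    using CD'(5)[of a b] ab unfolding closed_nbhd_insert[of G h Y] by blast
  moreover have "b \<noteq> h"
  proof
    assume "b = h"
    then have "a \<in> closed_nbhd G {h}" using arc_sym[OF ab(3)] by (auto simp: closed_nbhd_def)
    with Ch ab(1) show False by blast
  qed
  ultimately have "(h, b) \<in> parcs G" by (auto simp: closed_nbhd_def)
  moreover have "a \<in> closed_nbhd G {b}" using arc_sym[OF ab(3)] by (auto simp: closed_nbhd_def)
  ultimately show ?thesis using that[of b] sub Ch ab by blast
qed

text \<open>The Gyarfas argument started at \<open>x\<close>. Keeping \<open>Y\<close> among the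
  removed centres holds the path inside \<open>C0\<close>, and each new vertex costs one more
  centre, \<open>n\<close> in all.\<close>

lemma induced_path_into_heavy_component:
  assumes I: "finite I"
    and sep: "\<And>Z. finite Z \<Longrightarrow> card Z \<le> L \<Longrightarrow> \<exists>D. heavy_component G I Z D"
    and C0: "heavy_component G I Y C0" and Y: "finite Y" "card Y + n \<le> L"
    and x: "x \<in> pverts G" "closed_nbhd G {x} \<inter> C0 \<noteq> {}"
  shows "\<exists>xs. length xs = n \<and> set xs \<subseteq> C0 \<and> induced_path G (xs @ [x])"
proof -
  \<comment> \<open>The neighbourhood of the newest vertex \<open>h\<close> is not removed yet: it
    still has to reach \<open>C\<close>, whereas \<open>C\<close> avoids the neighbourhoods of all
    of \<open>t\<close>.\<close>
  have "\<exists>h t xs C. h # t = xs @ [x] \<and> length xs = n \<and> set xs \<subseteq> C0 \<and> induced_path G (h # t) \<and>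
    heavy_component G I (Y \<union> set t) C \<and> C \<subseteq> C0 \<and> closed_nbhd G {h} \<inter> C \<noteq> {}"
    using Y(2)
  proof (induction n)
    case 0
    have "induced_path G [x]" using x(1) arc_irrefl by (simp add: induced_path_def)
    with C0 x(2) show ?case
      by (intro exI[of _ x] exI[of _ "[]"] exI[of _ "[]"] exI[of _ C0]) simp
  next
    case (Suc n)
    then have "card Y + n \<le> L" by simp
    from Suc.IH[OF this] obtain h t xs C where IH: "h # t = xs @ [x]" "length xs = n" "set xs \<subseteq> C0"
      "induced_path G (h # t)" "heavy_component G I (Y \<union> set t) C" "C \<subseteq> C0"
      "closed_nbhd G {h} \<inter> C \<noteq> {}" by blast
    have "card (Y \<union> set (h # t)) \<le> card Y + card (set (h # t))" by (rule card_Un_le)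
    also have "card (set (h # t)) \<le> length (h # t)" by (rule card_length)
    also have "length (h # t) = Suc n" using IH(1,2) by simp
    finally have "card (Y \<union> set (h # t)) \<le> L" using Suc.prems by simp
    then obtain C' where C'': "heavy_component G I (Y \<union> set (h # t)) C'"
      using sep[of "Y \<union> set (h # t)"] Y(1) by blast
    then have C': "heavy_component G I (insert h (Y \<union> set t)) C'" by simp
    obtain b where b: "C' \<subseteq> C" "b \<in> C" "(h, b) \<in> parcs G" "closed_nbhd G {b} \<inter> C' \<noteq> {}"
      using heavy_component_insert[OF I IH(5,7) C'] by metis
    have "b \<notin> closed_nbhd G (set t)"
      using heavy_componentD(2)[OF IH(5)] b(2) unfolding closed_nbhd_Un by blast
    then have path: "induced_path G (b # h # t)" using induced_path_Cons[OF IH(4) b(3)] by blast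
    have "b \<in> C0" "C' \<subseteq> C0" using IH(6) b(1,2) by blast+
    then show ?case
      using IH(2,3) path C'' b(4) unfolding IH(1)
      by - (rule exI[of _ b], rule exI[of _ "xs @ [x]"], rule exI[of _ "b # xs"], rule exI[of _ C'], simp)
  qed
  then obtain h t xs where "h # t = xs @ [x]" "length xs = n" "set xs \<subseteq> C0"
    "induced_path G (h # t)" by blast
  then show ?thesis by (intro exI[of _ xs]) simp
qed

text \<open>The leg from \<open>x\<close> into the heavy component \<open>C\<close> together with the two directions on the path give
  \<open>S_p\<close> or \<open>T_p\<close>.\<close>
lemma nbr_of_heavy_component_near_ends:
  assumes I: "finite I" and p: "p \<ge> 1"
    and sep: "\<And>Z. finite Z \<Longrightarrow> card Z \<le> L \<Longrightarrow> \<exists>D. heavy_component G I Z D"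
    and S: "\<not> contains_induced (with_proj G) (with_proj (S_graph p))"
    and T: "\<not> contains_induced (with_proj G) (with_proj (T_graph p))"
    and path: "induced_path G Q"
    and C: "heavy_component G I Y C" "finite Y" "card Y + p \<le> L" "C \<inter> closed_nbhd G (set Q) = {}"
    and x: "(a, x) \<in> parcs G" "a \<in> C" "x \<in> closed_nbhd G (set Q)"
  shows "x \<in> closed_nbhd G (ends p Q)"
proof (rule ccontr)
  assume nx: "x \<notin> closed_nbhd G (ends p Q)"
  have xV: "x \<in> pverts G" using in_arcsD2[OF x(1)] .
  have xQ: "x \<notin> set Q"
  proof
    assume "x \<in> set Q"
    then have "a \<in> closed_nbhd G (set Q)" using arc_sym[OF x(1)] by (auto simp: closed_nbhd_def)
    with C(4) x(2) show False by blast
  qed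
  have "a \<in> closed_nbhd G {x}" using arc_sym[OF x(1)] by (auto simp: closed_nbhd_def)
  then have "closed_nbhd G {x} \<inter> C \<noteq> {}" using x(2) by blast
  then obtain xs where xs: "length xs = p" "set xs \<subseteq> C" "induced_path G (xs @ [x])"
    using induced_path_into_heavy_component[OF I sep C(1-3) xV] by blast
  let ?m = "length Q"
  \<comment> \<open>The list ends in \<open>x\<close>; reading it backwards gives
    \<open>f 0 = x\<close> and makes \<open>t\<close> the distance from \<open>x\<close>.\<close>
  define f where "f t = (xs @ [x]) ! (p - t)" for t
  have f0: "f 0 = x" using xs(1) by (simp add: f_def nth_append)
  have fC: "f t \<in> C" if "0 < t" "t \<le> p" for t
  proof -
    have "p - t < length xs" using that xs(1) by simp
    then have "f t \<in> set xs" by (simp add: f_def nth_append)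
    then show ?thesis using xs(2) by blast
  qed
  define N where "N = {b. b < ?m \<and> (x, Q ! b) \<in> parcs G}"
  have finN: "finite N" by (simp add: N_def)
  obtain y where y: "y \<in> set Q" "(y, x) \<in> parcs G" using x(3) xQ by (auto simp: closed_nbhd_def)
  then have "N \<noteq> {}" using arc_sym[OF y(2)] by (auto simp: N_def in_set_conv_nth)
  with finN have mm: "Min N \<in> N" "Max N \<in> N" by auto
  \<comment> \<open>A neighbour of \<open>x\<close> closer to an end of \<open>Q\<close> would put
    \<open>x\<close> into the neighbourhood of the ends. So the outermost neighbours
    \<open>Min N\<close> and \<open>Max N\<close> leave room for a leg on either side.\<close>
  have far: "p \<le> b \<and> b + p < ?m" if "b \<in> N" for b
  proof (rule ccontr)
    assume "\<not> (p \<le> b \<and> b + p < ?m)"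
    then have "Q ! b \<in> ends p Q" using that nth_in_ends[of b Q p] by (auto simp: N_def)
    moreover have "(Q ! b, x) \<in> parcs G" using that arc_sym by (auto simp: N_def)
    ultimately show False using nx by (auto simp: closed_nbhd_def)
  qed
  have "contains_induced (with_proj G) (with_proj (S_graph p)) \<or>
    contains_induced (with_proj G) (with_proj (T_graph p))"
  proof (rule contains_S_or_T_graph[OF p, of ?m "\<lambda>b. Q ! b" f "Min N" "Max N"])
    fix b c assume bc: "b < ?m" "c < ?m"
    show "Q ! b = Q ! c \<longleftrightarrow> b = c"
      using bc path by (simp add: induced_path_def nth_eq_iff_index_eq)
    show "(Q ! b, Q ! c) \<in> parcs G \<longleftrightarrow> c = Suc b \<or> b = Suc c"
      using bc path by (simp add: induced_path_def)
  next
    fix t u assume tu: "t \<le> p" "u \<le> p"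
    have lt: "p - t < length (xs @ [x])" "p - u < length (xs @ [x])" using xs(1) by auto
    have "f t = f u \<longleftrightarrow> p - t = p - u"
      unfolding f_def using xs(3) nth_eq_iff_index_eq[OF _ lt] by (simp add: induced_path_def)
    then show "f t = f u \<longleftrightarrow> t = u" using tu by auto
    have "(f t, f u) \<in> parcs G \<longleftrightarrow> p - u = Suc (p - t) \<or> p - t = Suc (p - u)"
      unfolding f_def using xs(3) lt unfolding induced_path_def by blast
    then show "(f t, f u) \<in> parcs G \<longleftrightarrow> u = Suc t \<or> t = Suc u" using tu by auto
  next
    fix t b assume tb: "t \<le> p" "b < ?m"
    show "f t \<noteq> Q ! b"
    proof (cases "t = 0")
      case True
      then show ?thesis using f0 xQ tb(2) by auto
    next
      case False
      then have "f t \<in> C" using fC[of t] tb by simp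
      moreover have "Q ! b \<notin> C" using C(4) closed_nbhd_self[of "set Q" G] nth_mem[OF tb(2)] by blast
      ultimately show ?thesis by metis
    qed
    show "(f t, Q ! b) \<notin> parcs G" if "0 < t"
    proof
      assume "(f t, Q ! b) \<in> parcs G"
      then have "f t \<in> closed_nbhd G (set Q)"
        using arc_sym nth_mem[OF tb(2)] unfolding closed_nbhd_def by blast
      with fC[OF that tb(1)] C(4) show False by blast
    qed
  next
    show "f t \<in> pverts G" if "t \<le> p" for t
      using fC[of t] that f0 xV heavy_componentD(1)[OF C(1)] by (cases "t = 0") auto
    show "Q ! b \<in> pverts G" if "b < ?m" for b
      using that path nth_mem[OF that] by (auto simp: induced_path_def)
    show "p \<le> Min N" "Max N + p < ?m" using far mm by auto
    show "(f 0, Q ! Min N) \<in> parcs G" "(f 0, Q ! Max N) \<in> parcs G"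
      using mm by (auto simp: f0 N_def)
    show "Min N \<le> b \<and> b \<le> Max N" if "b < ?m" "(f 0, Q ! b) \<in> parcs G" for b
      using that finN by (auto simp: f0 N_def)
  qed
  with S T show False by blast
qed

text \<open>The invariant that \<open>C\<close> is a component after removing only the neighbourhood of the two ends of
  \<open>t\<close>, rather than of all of \<open>t\<close>, keeps the separators of size at most \<open>3p + 1\<close> however long the path
  becomes.\<close>
lemma long_induced_path:
  assumes I: "finite I" and p: "p \<ge> 1"
    and sep: "\<And>Z. finite Z \<Longrightarrow> card Z \<le> 3 * p + 1 \<Longrightarrow> \<exists>D. heavy_component G I Z D"
    and S: "\<not> contains_induced (with_proj G) (with_proj (S_graph p))"
    and T: "\<not> contains_induced (with_proj G) (with_proj (T_graph p))"
  shows "\<exists>h t C. length t = n \<and> induced_path G (h # t) \<and> heavy_component G I (ends p t) C \<and>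
    C \<inter> closed_nbhd G (set t) = {} \<and> closed_nbhd G {h} \<inter> C \<noteq> {}"
proof (induction n)
  case 0
  obtain C where C: "heavy_component G I {} C" using sep[of "{}"] by auto
  then obtain h where h: "h \<in> C" using heavy_componentD(3) by blast
  then have "h \<in> pverts G" using heavy_componentD(1)[OF C] by blast
  then have "induced_path G [h]" using arc_irrefl by (simp add: induced_path_def)
  moreover have "h \<in> closed_nbhd G {h}" by (simp add: closed_nbhd_def)
  ultimately show ?case
    using C h by (intro exI[of _ h] exI[of _ "[]"] exI[of _ C]) (auto simp: ends_def closed_nbhd_def)
next
  case (Suc n)
  then obtain h t C where IH: "length t = n" "induced_path G (h # t)"
    "heavy_component G I (ends p t) C" "C \<inter> closed_nbhd G (set t) = {}"
    "closed_nbhd G {h} \<inter> C \<noteq> {}" by blast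
  let ?Y = "insert h (ends p t)"
  have fin: "finite ?Y" by (simp add: ends_def)
  have "card ?Y \<le> Suc (card (ends p t))" by (rule card_insert_le_m1) simp_all
  \<comment> \<open>At most \<open>2 * p\<close> end vertices and \<open>h\<close> are removed now;
    the remaining \<open>p\<close> pay for the leg from \<open>x\<close> into the component.\<close>
  then have card: "card ?Y + p \<le> 3 * p + 1" using card_ends[of p t] by linarith
  then obtain C' where C': "heavy_component G I ?Y C'" using sep[OF fin] by auto
  obtain b where b: "C' \<subseteq> C" "C' \<inter> closed_nbhd G {h} = {}" "b \<in> C" "(h, b) \<in> parcs G"
      "closed_nbhd G {b} \<inter> C' \<noteq> {}"
    using heavy_component_insert[OF I IH(3,5) C'] by metis
  have path: "induced_path G (b # h # t)"
    using induced_path_Cons[OF IH(2) b(4)] IH(4) b(3) by blast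
  have disj: "C' \<inter> closed_nbhd G (set (h # t)) = {}"
    using IH(4) b(1,2) closed_nbhd_insert[of G h "set t"] by auto
  note CD = heavy_componentD[OF C']
  \<comment> \<open>Removing less could enlarge \<open>C'\<close>. But any neighbour of
    \<open>C'\<close> in the neighbourhood of \<open>?Y\<close> is in that of the whole path, hence
    in that of its ends, by the previous lemma.\<close>
  have "component G (pverts G - closed_nbhd G (ends p (h # t))) C'"
    unfolding component_def
  proof (intro conjI ballI impI)
    show "C' \<subseteq> pverts G - closed_nbhd G (ends p (h # t))"
      using CD(1,2) closed_nbhd_mono[OF ends_Cons_subset[of p h t], of G] by blast
    fix a x assume ax: "a \<in> C'" "x \<in> pverts G - closed_nbhd G (ends p (h # t))" "(a, x) \<in> parcs G"
    show "x \<in> C'"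
    proof (rule ccontr)
      assume "x \<notin> C'"
      then have "x \<in> closed_nbhd G ?Y" using CD(5)[OF ax(1) _ _ ax(3)] ax(2) by blast
      moreover have "?Y \<subseteq> set (h # t)" using ends_subset[of p t] by auto
      ultimately have "x \<in> closed_nbhd G (set (h # t))" using closed_nbhd_mono by blast
      then have "x \<in> closed_nbhd G (ends p (h # t))"
        using nbr_of_heavy_component_near_ends[OF I p sep S T IH(2) C' fin card disj ax(3,1)] by blast
      with ax(2) show False by blast
    qed
  qed (use CD in auto)
  then have "heavy_component G I (ends p (h # t)) C'"
    using CD(6) by (simp add: heavy_component_def)
  then show ?case
    using IH(1) path disj b(5) by (intro exI[of _ b] exI[of _ "h # t"] exI[of _ C']) simp
qed

text \<open>If every such \<open>Z\<close> failed, heavy components would always exist and there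
  would be an induced path with one vertex more than \<open>G\<close> has.\<close>

lemma ex_balanced_separator:
  assumes I: "finite I" and p: "p \<ge> 1"
    and S: "\<not> contains_induced (with_proj G) (with_proj (S_graph p))"
    and T: "\<not> contains_induced (with_proj G) (with_proj (T_graph p))"
  obtains Z where "finite Z" "card Z \<le> 3 * p + 1"
    "\<And>D. component G (pverts G - closed_nbhd G Z) D \<Longrightarrow> 2 * card (I \<inter> D) \<le> card I"
proof (rule ccontr)
  assume "\<not> thesis"
  then have sep: "\<exists>D. heavy_component G I Z D" if "finite Z" "card Z \<le> 3 * p + 1" for Z
    using that \<open>\<not> thesis\<close> \<open>\<And>Z. \<lbrakk>finite Z; card Z \<le> 3 * p + 1;
      \<And>D. component G (pverts G - closed_nbhd G Z) D \<Longrightarrow> 2 * card (I \<inter> D) \<le> card I\<rbrakk> \<Longrightarrow> thesis\<close>[of Z]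
    unfolding heavy_component_def by (meson not_le)
  obtain h t where "length t = card (pverts G)" "induced_path G (h # t)"
    using long_induced_path[OF I p sep S T] by metis
  then have "card (set (h # t)) = Suc (card (pverts G))" "set (h # t) \<subseteq> pverts G"
    unfolding induced_path_def using distinct_card[of "h # t"] by auto
  then show False using card_mono[OF pair_finite_verts, of "set (h # t)"] by simp
qed

text \<open>An independent set containing \<open>y\<close> is just \<open>{y}\<close> here;
  otherwise it consists of neighbours of \<open>y\<close>, and \<open>d\<close> of them form an
  induced star with centre \<open>y\<close>.\<close>

lemma alpha_le_closed_nbhd_singleton:
  assumes d: "d \<ge> 2" and star: "\<not> contains_induced (with_proj G) (with_proj (star_graph d))"
  shows "alpha_le G (closed_nbhd G {y}) (d - 1)"
  unfolding alpha_le_def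
proof (intro allI impI)
  fix I assume I: "I \<subseteq> closed_nbhd G {y}" "independent_set (with_proj G) I"
  show "card I \<le> d - 1"
  proof (cases "y \<in> I")
    case True
    then have "I \<subseteq> {y}" using I unfolding independent_set_iff closed_nbhd_def by blast
    then have "card I \<le> card {y}" by (intro card_mono) auto
    then show ?thesis using d by simp
  next
    case False
    then have N: "(y, v) \<in> parcs G" if "v \<in> I" for v
      using I(1) that by (auto simp: closed_nbhd_def)
    show ?thesis
    proof (rule ccontr)
      assume "\<not> card I \<le> d - 1"
      then have "d \<le> card I" by simp
      then obtain J where J: "J \<subseteq> I" "card J = d" "finite J" using obtain_subset_with_card_n by metis
      then have "card {1..d} = card J" by simp
      then obtain g where g: "bij_betw g {1..d} J"
        using J(3) bij_betw_iff_card[of "{1..d}" J] by auto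
      have gJ: "g i \<in> I" if "1 \<le> i" "i \<le> d" for i
        using g that J(1) by (auto simp: bij_betw_def)
      define \<phi> where "\<phi> i = (if i = 0 then y else g i)" for i
      have "contains_induced (with_proj G) (with_proj (star_graph d))"
      proof (rule contains_inducedI)
        show "inj_on \<phi> {0..d}"
        proof (rule inj_onI)
          fix i j assume "i \<in> {0..d}" "j \<in> {0..d}" "\<phi> i = \<phi> j"
          then show "i = j"
            using g gJ False inj_onD[of g "{1..d}" i j]
            by (cases "i = 0"; cases "j = 0") (auto simp: \<phi>_def bij_betw_def)
        qed
        have "y \<in> pverts G" using N gJ[of 1] d in_arcsD1 by auto
        then show "\<phi> ` {0..d} \<subseteq> pverts G"
          using gJ I(2) by (auto simp: \<phi>_def independent_set_iff)
        show "bij_betw id {0..d} (pverts (star_graph d))" by (simp add: star_graph_def)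
        show "parcs (star_graph d) \<subseteq> pverts (star_graph d) \<times> pverts (star_graph d)"
          by (auto simp: star_graph_def)
        show "(\<phi> i, \<phi> j) \<in> parcs G \<longleftrightarrow> (id i, id j) \<in> parcs (star_graph d)"
          if "i \<in> {0..d}" "j \<in> {0..d}" for i j
        proof -
          have "(g i, g j) \<notin> parcs G" if "1 \<le> i" "i \<le> d" "1 \<le> j" "j \<le> d" for i j
            using gJ[OF that(1,2)] gJ[OF that(3,4)] I(2) unfolding independent_set_iff by blast
          moreover have "(y, g i) \<in> parcs G" "(g i, y) \<in> parcs G" if "1 \<le> i" "i \<le> d" for i
            using N[OF gJ[OF that]] arc_sym by blast+
          ultimately show ?thesis
            using that arc_irrefl by (cases "i = 0"; cases "j = 0") (auto simp: \<phi>_def star_graph_def)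
        qed
      qed
      with star show False by blast
    qed
  qed
qed

lemma alpha_le_closed_nbhd:
  assumes "finite Z" "\<And>y. alpha_le G (closed_nbhd G {y}) k"
  shows "alpha_le G (closed_nbhd G Z) (card Z * k)"
  using assms(1)
proof (induction Z rule: finite_induct)
  case empty
  show ?case by (auto simp: alpha_le_def closed_nbhd_def)
next
  case (insert z Z)
  have "alpha_le G (closed_nbhd G {z} \<union> closed_nbhd G Z) (k + card Z * k)"
    by (rule alpha_le_Un[OF assms(2) insert.IH])
  then show ?case using insert.hyps by (simp add: closed_nbhd_insert[of G z Z])
qed

end

theorem theorem4p9:
  fixes G :: "'a pair_pre_digraph" and d p :: nat
  assumes "d \<ge> 2" and "p \<ge> 1"
    and "pair_graph G"
    and "\<not> contains_induced (with_proj G) (with_proj (star_graph d))"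
    and "\<not> contains_induced (with_proj G) (with_proj (S_graph p))"
    and "\<not> contains_induced (with_proj G) (with_proj (T_graph p))"
  shows "tree_alpha G \<le> 20 * (d - 1) ^ 4 * (p + 1)"
proof -
  interpret pair_graph G by fact
  \<comment> \<open>At most \<open>3 * p + 1\<close> centres, each contributing at most
    \<open>d - 1\<close> independent vertices to the separator.\<close>
  let ?k = "(3 * p + 1) * (d - 1)"
  have "tree_alpha G \<le> 5 * ?k"
  proof (rule tree_alpha_le_balanced_separators)
    show "0 < ?k" using assms(1) by simp
    fix I assume "independent_set (with_proj G) I"
    then have "finite I" using pair_finite_verts finite_subset unfolding independent_set_iff by blast
    then obtain Z where Z: "finite Z" "card Z \<le> 3 * p + 1"
      "\<And>D. component G (pverts G - closed_nbhd G Z) D \<Longrightarrow> 2 * card (I \<inter> D) \<le> card I"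
      using ex_balanced_separator[OF _ assms(2,5,6)] by metis
    have "alpha_le G (closed_nbhd G Z) (card Z * (d - 1))"
      using alpha_le_closed_nbhd[OF Z(1)] alpha_le_closed_nbhd_singleton[OF assms(1,4)] by blast
    then have "alpha_le G (closed_nbhd G Z) ?k"
      by (rule alpha_le_mono) (use Z(2) in \<open>rule mult_le_mono1\<close>)
    with Z(3) show "\<exists>S. alpha_le G S ?k \<and>
        (\<forall>D. component G (pverts G - S) D \<longrightarrow> 2 * card (I \<inter> D) \<le> card I)" by blast
  qed
  also have "5 * ?k \<le> 20 * (d - 1) ^ 4 * (p + 1)"
  proof -
    \<comment> \<open>Here \<open>5 * (3 * p + 1)\<close> is at most \<open>20 * (p + 1)\<close>,
      and \<open>d - 1\<close> is at most its fourth power since it is positive.\<close>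
    have "(d - 1) ^ 1 \<le> (d - 1) ^ 4" using assms(1) by (intro power_increasing) auto
    then have "(5 * (3 * p + 1)) * (d - 1) \<le> (20 * (p + 1)) * (d - 1) ^ 4"
      by (intro mult_le_mono[of "5 * (3 * p + 1)"]) auto
    then show ?thesis by (simp only: mult.assoc mult.commute mult.left_commute)
  qed
  finally show ?thesis .
qed

end
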